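(* Assume (A1)–(A3) hold. Fix a time step $\Delta t>0$, an index $n\ge1$ and previous-step values $(\xi_h^{n-1},p_h^{n-1},T_h^{n-1})\in Q_h\times W_h\times W_h$. Let $(\mathbf u_h^n,\xi_h^n,p_h^n,T_h^n)\in\mathbf V_h\times Q_h\times W_h\times W_h$ be the solution of the coupled problem: for all $(\mathbf v_h,\phi_h,q_h,S_h)\in\mathbf V_h\times Q_h\times W_h\times W_h$, $$2\mu(\boldsymbol\varepsilon(\mathbf u_h^n),\boldsymbol\varepsilon(\mathbf v_h))-(\nabla\cdot\mathbf v_h,\xi_h^n)=(\mathbf f,\mathbf v_h),$$ $$-(\nabla\cdot\mathbf u_h^n,\phi_h)-\tfrac1\lambda(\xi_h^n,\phi_h)+\tfrac\alpha\lambda(p_h^n,\phi_h)+\tfrac\beta\lambda(T_h^n,\phi_h)=0,$$ $$-\tfrac\alpha\lambda(\xi_h^n,q_h)+(c_0+\tfrac{\alpha^2}\lambda)(p_h^n,q_h)+(\tfrac{\alpha\beta}\lambda-b_0)(T_h^n,q_h)+\Delta t(\mathbf K\nabla p_h^n,\nabla q_h)=(c_0+\tfrac{\alpha^2}\lambda)(p_h^{n-1},q_h)+(\tfrac{\alpha\beta}\lambda-b_0)(T_h^{n-1},q_h)-\tfrac\alpha\lambda(\xi_h^{n-1},q_h)+\Delta t(g,q_h),$$ $$-\tfrac\beta\lambda(\xi_h^n,S_h)+(a_0+\tfrac{\beta^2}\lambda)(T_h^n,S_h)+(\tfrac{\alpha\beta}\lambda-b_0)(p_h^n,S_h)+\Delta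 t(\boldsymbol\Theta\nabla T_h^n,\nabla S_h)=(a_0+\tfrac{\beta^2}\lambda)(T_h^{n-1},S_h)+(\tfrac{\alpha\beta}\lambda-b_0)(p_h^{n-1},S_h)-\tfrac\beta\lambda(\xi_h^{n-1},S_h)+\Delta t(H_s,S_h).$$ Define iterates by $\xi_h^{n,0}=\xi_h^{n-1}$, $p_h^{n,0}=p_h^{n-1}$, $T_h^{n,0}=T_h^{n-1}$ and, for $i\ge1$: Step 1: find $(p_h^{n,i},T_h^{n,i})\in W_h\times W_h$ such that for all $(q_h,S_h)\in W_h\times W_h$ $$(c_0+\tfrac{\alpha^2}\lambda)(p_h^{n,i},q_h)+(\tfrac{\alpha\beta}\lambda-b_0)(T_h^{n,i},q_h)+\Delta t(\mathbf K\nabla p_h^{n,i},\nabla q_h)=\Delta t(g,q_h)+(c_0+\tfrac{\alpha^2}\lambda)(p_h^{n-1},q_h)+(\tfrac{\alpha\beta}\lambda-b_0)(T_h^{n-1},q_h)+\tfrac\alpha\lambda(\xi_h^{n,i-1},q_h)-\tfrac\alpha\lambda(\xi_h^{n-1},q_h),$$ $$(a_0+\tfrac{\beta^2}\lambda)(T_h^{n,i},S_h)+(\tfrac{\alpha\beta}\lambda-b_0)(p_h^{n,i},S_h)+\Delta t(\boldsymbol\Theta\nabla T_h^{n,i},\nabla S_h)=\Delta t(H_s,S_h)+(a_0+\tfrac{\beta^2}\lambda)(T_h^{n-1},S_h)+(\tfrac{\alpha\beta}\lambda-b_0)(p_h^{n-1},S_h)+\tfrac\beta\lambda(\xi_h^{n,i-1},S_h)-\tfrac\beta\lambda(\xi_h^{n-1},S_h);$$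 Step 2: find $(\mathbf u_h^{n,i},\xi_h^{n,i})\in\mathbf V_h\times Q_h$ such that for all $(\mathbf v_h,\phi_h)\in\mathbf V_h\times Q_h$ $$2\mu(\boldsymbol\varepsilon(\mathbf u_h^{n,i}),\boldsymbol\varepsilon(\mathbf v_h))-(\nabla\cdot\mathbf v_h,\xi_h^{n,i})=(\mathbf f,\mathbf v_h),\qquad(\nabla\cdot\mathbf u_h^{n,i},\phi_h)+\tfrac1\lambda(\xi_h^{n,i},\phi_h)=\tfrac\alpha\lambda(p_h^{n,i},\phi_h)+\tfrac\beta\lambda(T_h^{n,i},\phi_h).$$ Then the sequence $\{(\mathbf u_h^{n,i},\xi_h^{n,i},p_h^{n,i},T_h^{n,i})\}_{i=1}^\infty$ converges to $(\mathbf u_h^n,\xi_h^n,p_h^n,T_h^n)$ as $i\to\infty$.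
   Context: Let $\Omega\subset\mathbb R^2$ be a bounded polygonal domain with boundary $\partial\Omega=\Gamma_d\cup\Gamma_n$, $\Gamma_d\neq\partial\Omega$. $(\cdot,\cdot)$ is the $L^2(\Omega)$ inner product, $\boldsymbol\varepsilon(\mathbf u)=\frac12(\nabla\mathbf u+\nabla\mathbf u^T)$. Assumptions: (A1) $\mathbf K,\boldsymbol\Theta$ are $2\times2$ matrix fields, constant in time, symmetric positive definite, with constants $k_m,k_M,\theta_m,\theta_M>0$ such that $k_m|\mathbf v|^2\le\mathbf v^T\mathbf K(x)\mathbf v$, $|\mathbf K(x)\mathbf v|\le k_M|\mathbf v|$, $\theta_m|\mathbf v|^2\le\mathbf v^T\boldsymbol\Theta(x)\mathbf v$, $|\boldsymbol\Theta(x)\mathbf v|\le\theta_M|\mathbf v|$ for all nonzero $\mathbf v$; (A2) $\lambda,\mu,\alpha,\beta>0$ constants; (A3) constants $a_0,c_0\ge b_0\ge0$. Data $\mathbf f\in L^2(\Omega)^2$, $g,H_s\in L^2(\Omega)$. Let $\mathcal T_h$ be a shape-regular, quasi-uniform triangulation of $\Omega$ with mesh size $h$. Finite element spaces: $\mathbf V_h=\{\mathbf v_h\in C^0(\bar\Omega)^2:\mathbf v_h|_K\in\mathbb P_2(K)^2\ \forall K\in\mathcal T_h,\ \mathbf v_h=0\text{ on }\Gamma_d\}$; $Q_h=\{\phi_h\in C^0(\bar\Omega):\phi_h|_K\in\mathbb P_1(K)\ \forall K\}$; $W_h=\{q_h\in C^0(\bar\Omega):q_h|_K\in\mathbb P_1(K)\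 \forall K,\ q_h=0\text{ on }\partial\Omega\}$ (Taylor–Hood pair $\mathbf V_h\times Q_h$, assumed to satisfy the uniform discrete inf-sup condition $\inf_{\xi\in Q_h}\sup_{\mathbf v\in\mathbf V_h}\frac{(\nabla\cdot\mathbf v,\xi)}{\|\mathbf v\|_{H^1}\|\xi\|_{L^2}}\ge\gamma>0$ with $\gamma$ independent of $h$).
   Formalization: It is additionally assumed that Γ_d contains a nondegenerate line segment; without this (e.g. Γ_d = ∅) V_h contains rigid motions, the displacement is not unique, and the iterates u_h^{n,i} need not converge. *)

theory Defs
  imports "HOL-Analysis.Analysis"
begin

definition triangle :: "(real^2) set \<Rightarrow> bool" where
  "triangle T \<longleftrightarrow> (\<exists>a b c. \<not> collinear {a, b, c} \<and> T = convex hull {a, b, c})"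

definition verts :: "(real^2) set \<Rightarrow> (real^2) set" where
  "verts T = {x. x extreme_point_of T}"

text \<open>A conforming triangulation Th of the (polygonal) domain Omega:
  finitely many nondegenerate triangles covering the closure of Omega, Omega being the
  interior of their union, and two distinct triangles meet only in a common vertex,
  a common edge, or not at all.\<close>
definition triangulation :: "(real^2) set \<Rightarrow> (real^2) set set \<Rightarrow> bool" where
  "triangulation \<Omega> Th \<longleftrightarrow> finite Th \<and> Th \<noteq> {} \<and> (\<forall>T\<in>Th. triangle T)
     \<and> \<Omega> = interior (\<Union>Th)
     \<and> (\<forall>T1\<in>Th. \<forall>T2\<in>Th. T1 \<noteq> T2 \<longrightarrow> T1 \<inter> T2 = convex hull (verts T1 \<inter> verts T2))"

definition Pk :: "nat \<Rightarrow> (real^2 \<Rightarrow> real) \<Rightarrow> bool" where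
  "Pk k p \<longleftrightarrow> (\<exists>c. \<forall>x. p x = (\<Sum>a\<le>k. \<Sum>b\<le>k - a. c a b * (x$1)^a * (x$2)^b))"

definition Vh :: "(real^2) set \<Rightarrow> (real^2) set set \<Rightarrow> (real^2) set \<Rightarrow> (real^2 \<Rightarrow> real^2) set" where
  "Vh \<Omega> Th \<Gamma>d = {v. continuous_on (closure \<Omega>) v
       \<and> (\<forall>K\<in>Th. \<forall>j. \<exists>p. Pk 2 p \<and> (\<forall>x\<in>K. v x $ j = p x))
       \<and> (\<forall>x\<in>\<Gamma>d. v x = 0)}"

definition Qh :: "(real^2) set \<Rightarrow> (real^2) set set \<Rightarrow> (real^2 \<Rightarrow> real) set" where
  "Qh \<Omega> Th = {\<phi>. continuous_on (closure \<Omega>) \<phi>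
       \<and> (\<forall>K\<in>Th. \<exists>p. Pk 1 p \<and> (\<forall>x\<in>K. \<phi> x = p x))}"

definition Wh :: "(real^2) set \<Rightarrow> (real^2) set set \<Rightarrow> (real^2 \<Rightarrow> real) set" where
  "Wh \<Omega> Th = {q \<in> Qh \<Omega> Th. \<forall>x\<in>frontier \<Omega>. q x = 0}"

section \<open>Differential operators (pointwise, a.e. defined for piecewise polynomials)\<close>

definition pd :: "(real^2 \<Rightarrow> 'b::real_normed_vector) \<Rightarrow> 2 \<Rightarrow> real^2 \<Rightarrow> 'b" where
  "pd f j x = (if f differentiable (at x) then frechet_derivative f (at x) (axis j 1) else 0)"

definition grad :: "(real^2 \<Rightarrow> real) \<Rightarrow> real^2 \<Rightarrow> real^2" where
  "grad f x = (\<chi> j. pd f j x)"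

definition jac :: "(real^2 \<Rightarrow> real^2) \<Rightarrow> real^2 \<Rightarrow> real^2^2" where
  "jac u x = (\<chi> i j. pd u j x $ i)"

definition divg :: "(real^2 \<Rightarrow> real^2) \<Rightarrow> real^2 \<Rightarrow> real" where
  "divg u x = pd u 1 x $ 1 + pd u 2 x $ 2"

definition epsm :: "(real^2 \<Rightarrow> real^2) \<Rightarrow> real^2 \<Rightarrow> real^2^2" where
  "epsm u x = (1/2) *\<^sub>R (jac u x + transpose (jac u x))"

definition ip :: "(real^2) set \<Rightarrow> (real^2 \<Rightarrow> 'a::real_inner) \<Rightarrow> (real^2 \<Rightarrow> 'a) \<Rightarrow> real" where
  "ip \<Omega> f g = integral\<^sup>L (lebesgue_on \<Omega>) (\<lambda>x. f x \<bullet> g x)"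

definition L2norm :: "(real^2) set \<Rightarrow> (real^2 \<Rightarrow> 'a::real_inner) \<Rightarrow> real" where
  "L2norm \<Omega> f = sqrt (ip \<Omega> f f)"

definition H1norm :: "(real^2) set \<Rightarrow> (real^2 \<Rightarrow> real^2) \<Rightarrow> real" where
  "H1norm \<Omega> v = sqrt (ip \<Omega> v v + ip \<Omega> (jac v) (jac v))"

definition L2fun :: "(real^2) set \<Rightarrow> (real^2 \<Rightarrow> 'a::real_inner) \<Rightarrow> bool" where
  "L2fun \<Omega> f \<longleftrightarrow> f \<in> borel_measurable (lebesgue_on \<Omega>)
      \<and> integrable (lebesgue_on \<Omega>) (\<lambda>x. (norm (f x))^2)"

definition spd_field :: "(real^2) set \<Rightarrow> (real^2 \<Rightarrow> real^2^2) \<Rightarrow> real \<Rightarrow> real \<Rightarrow> bool" where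
  "spd_field \<Omega> K m M \<longleftrightarrow>
     (\<forall>x\<in>\<Omega>. transpose (K x) = K x
        \<and> (\<forall>v. m * (norm v)^2 \<le> v \<bullet> (K x *v v) \<and> norm (K x *v v) \<le> M * norm v))
     \<and> (\<forall>i j. (\<lambda>x. K x $ i $ j) \<in> borel_measurable (lebesgue_on \<Omega>))"

definition inf_sup :: "(real^2) set \<Rightarrow> (real^2) set set \<Rightarrow> (real^2) set \<Rightarrow> real \<Rightarrow> bool" where
  "inf_sup \<Omega> Th \<Gamma>d \<gamma> \<longleftrightarrow>
     (\<forall>\<xi>\<in>Qh \<Omega> Th. L2norm \<Omega> \<xi> \<noteq> 0 \<longrightarrow>
        (SUP v\<in>{v \<in> Vh \<Omega> Th \<Gamma>d. H1norm \<Omega> v \<noteq> 0}.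
            ip \<Omega> (divg v) \<xi> / (H1norm \<Omega> v * L2norm \<Omega> \<xi>)) \<ge> \<gamma>)"

end

theory Submission
  imports Defs
begin

text \<open>Testing the error equations with the errors themselves and using Young's inequality shows that
  the squared L2 norm of the error in xi decreases along the iteration, each decrement
  dominating the squared L2 norms of grad e_p, grad e_T and eps(e_u). A decreasing nonnegative
  sequence converges, so these seminorms tend to zero. On a single triangle they control the
  coefficients of the error polynomials up to constants and rigid motions respectively; the boundary
  values fix the latter on one triangle, and the smallness spreads across common edges to the whole
  mesh. Hence e_u, e_p, e_T tend to zero uniformly, and then so does e_xi, which is bounded in L2 by
  alpha e_p + beta e_T.\<close>

section \<open>Essentially bounded functions and the L2 inner product\<close>

text \<open>Both steps of the iteration meet in \<open>z = alpha e_p + beta e_T\<close>. With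
  \<open>B\<close> and \<open>Z\<close> the squared norms of the errors in xi and of
  \<open>z\<close>, unweighted Young inequalities give \<open>B (Suc i) <= Z i <= B i\<close>, and
  the dissipation is what is lost in between. The constant is exactly one, so these two comparisons
  alone give no contraction; the dissipation has to do the work. Passing from vanishing seminorms to
  convergence would usually call for Poincare and Korn inequalities; on a fixed mesh the
  coefficients live in a fixed finite-dimensional space, and compactness replaces them. The
  technical obstacle is that \<open>pd\<close> is 0 wherever differentiability fails, so
  \<open>grad\<close>, \<open>epsm\<close> and \<open>divg\<close> are linear only almost
  everywhere, and integrals split only for integrable integrands. Measurable functions with an
  almost-everywhere bound are a convenient working class: it is closed under linear combinations,
  contains the discrete fields, their derivatives and the fluxes, and its inner products are
  integrable on sets of finite measure.\<close>

definition ess_bounded :: "(real^2) set \<Rightarrow> (real^2 \<Rightarrow> 'a::euclidean_space) \<Rightarrow> bool" where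
  "ess_bounded S f \<longleftrightarrow> f \<in> borel_measurable (lebesgue_on S)
     \<and> (\<exists>B. AE x in lebesgue_on S. norm (f x) \<le> B)"

lemma finite_measure_lebesgue_on: "S \<in> lmeasurable \<Longrightarrow> finite_measure (lebesgue_on S)"
  by (auto intro!: finite_measureI simp: emeasure_restrict_space fmeasurable_def)

lemma ess_bounded_integrable_inner:
  assumes "S \<in> lmeasurable" "ess_bounded S f" "ess_bounded S g"
  shows "integrable (lebesgue_on S) (\<lambda>x. f x \<bullet> g x)"
proof -
  interpret finite_measure "lebesgue_on S"
    by (rule finite_measure_lebesgue_on) fact
  obtain B C where B: "AE x in lebesgue_on S. norm (f x) \<le> B"
    and C: "AE x in lebesgue_on S. norm (g x) \<le> C"
    using assms by (auto simp: ess_bounded_def)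
  have "AE x in lebesgue_on S. norm (f x \<bullet> g x) \<le> B * C"
    using B C
  proof eventually_elim
    case (elim x)
    have "norm (f x \<bullet> g x) \<le> norm (f x) * norm (g x)"
      by (simp add: Cauchy_Schwarz_ineq2)
    also have "\<dots> \<le> B * C"
      using elim by (intro mult_mono) (auto intro: order_trans[OF norm_ge_zero])
    finally show ?case .
  qed
  then show ?thesis
    using assms by (intro integrable_const_bound) (auto simp: ess_bounded_def)
qed

lemma ess_bounded_diff:
  assumes "ess_bounded S f" "ess_bounded S g"
  shows "ess_bounded S (\<lambda>x. f x - g x)"
proof -
  obtain B C where B: "AE x in lebesgue_on S. norm (f x) \<le> B"
    and C: "AE x in lebesgue_on S. norm (g x) \<le> C"
    using assms by (auto simp: ess_bounded_def)
  have "AE x in lebesgue_on S. norm (f x - g x) \<le> B + C"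
    using B C by eventually_elim (metis add_mono norm_triangle_ineq4 order_trans)
  then show ?thesis
    using assms by (auto simp: ess_bounded_def)
qed

lemma ess_bounded_scaleR:
  assumes "ess_bounded S f"
  shows "ess_bounded S (\<lambda>x. r *\<^sub>R f x)"
proof -
  obtain B where B: "AE x in lebesgue_on S. norm (f x) \<le> B"
    using assms by (auto simp: ess_bounded_def)
  have "AE x in lebesgue_on S. norm (r *\<^sub>R f x) \<le> \<bar>r\<bar> * B"
    using B by eventually_elim (simp add: mult_left_mono)
  then show ?thesis
    using assms by (auto simp: ess_bounded_def)
qed

lemma ess_bounded_add:
  assumes "ess_bounded S f" "ess_bounded S g"
  shows "ess_bounded S (\<lambda>x. f x + g x)"
  using ess_bounded_diff[OF assms(1) ess_bounded_scaleR[OF assms(2), of "-1"]] by simp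

lemma ess_bounded_continuous:
  assumes "S \<in> sets lebesgue" "bounded S" "continuous_on UNIV f"
  shows "ess_bounded S f"
proof -
  have "compact (f ` closure S)"
    using assms by (intro compact_continuous_image) (auto intro: continuous_on_subset)
  then obtain B where "\<And>x. x \<in> closure S \<Longrightarrow> norm (f x) \<le> B"
    by (meson bounded_iff compact_imp_bounded image_eqI)
  then have "AE x in lebesgue_on S. norm (f x) \<le> B"
    using closure_subset by (intro AE_I2) auto
  then show ?thesis
    unfolding ess_bounded_def
    using assms by (auto intro!: continuous_imp_measurable_on_sets_lebesgue
        intro: continuous_on_subset)
qed

lemma ip_commute: "ip S f g = ip S g f"
  by (simp add: ip_def inner_commute)

lemma ip_nonneg: "0 \<le> ip S f f"
  by (simp add: ip_def)

text \<open>\<open>h\<close> is a separate function, tied to \<open>f - g\<close> only almost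
  everywhere, because it will be a derivative of a difference. On an edge two functions may fail to
  be differentiable while their difference is smooth, and there the default value of
  \<open>pd\<close> breaks linearity.\<close>

lemma ip_diff_AE:
  assumes "S \<in> lmeasurable" "ess_bounded S f" "ess_bounded S g" "ess_bounded S k"
    and "AE x in lebesgue_on S. h x = f x - g x" "ess_bounded S h"
  shows "ip S h k = ip S f k - ip S g k"
proof -
  have "ip S h k = integral\<^sup>L (lebesgue_on S) (\<lambda>x. f x \<bullet> k x - g x \<bullet> k x)"
    unfolding ip_def
  proof (rule integral_cong_AE)
    show "AE x in lebesgue_on S. h x \<bullet> k x = f x \<bullet> k x - g x \<bullet> k x"
      using assms(5) by eventually_elim (simp add: inner_diff_left)
  qed (use assms in \<open>auto simp: ess_bounded_def\<close>)
  also have "\<dots> = ip S f k - ip S g k"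
    unfolding ip_def by (intro Bochner_Integration.integral_diff ess_bounded_integrable_inner assms)
  finally show ?thesis .
qed

lemma ip_add_left:
  assumes "S \<in> lmeasurable" "ess_bounded S f" "ess_bounded S g" "ess_bounded S k"
  shows "ip S (\<lambda>x. f x + g x) k = ip S f k + ip S g k"
  using ip_diff_AE[OF assms(1) ess_bounded_add[OF assms(2,3)] assms(3,4), of f] assms by simp

lemma ip_scaleR_left:
  "ip S (\<lambda>x. r *\<^sub>R f x) k = r * ip S f k"
  by (simp add: ip_def)

text \<open>Expansion of the nonnegative \<open>ip\<close> of \<open>f - g\<close> with itself. The
  weights are equal so that half of each square can later be absorbed, which yields the constant one
  between successive errors.\<close>

lemma ip_Young:
  assumes "S \<in> lmeasurable" "ess_bounded S f" "ess_bounded S g"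
  shows "2 * ip S f g \<le> ip S f f + ip S g g"
proof -
  note d = ess_bounded_diff[OF assms(2,3)]
  have "ip S (\<lambda>x. f x - g x) (\<lambda>x. f x - g x)
      = ip S f (\<lambda>x. f x - g x) - ip S g (\<lambda>x. f x - g x)"
    by (rule ip_diff_AE) (use assms d in auto)
  also have "ip S f (\<lambda>x. f x - g x) = ip S f f - ip S g f"
    unfolding ip_commute[of S f "\<lambda>x. f x - g x"] by (rule ip_diff_AE) (use assms d in auto)
  also have "ip S g (\<lambda>x. f x - g x) = ip S f g - ip S g g"
    unfolding ip_commute[of S g "\<lambda>x. f x - g x"] by (rule ip_diff_AE) (use assms d in auto)
  finally show ?thesis
    using ip_nonneg[of S "\<lambda>x. f x - g x"] ip_commute[of S f g] by linarith
qed

text \<open>Localises a global bound: \<open>F\<close> will be a field on the whole domain and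
  \<open>k\<close> a scalar entry of it on one triangle. With indicators both integrals run over the
  plane, and enlarging set and integrand is a single monotonicity step.\<close>

lemma ip_mono:
  assumes "S \<in> lmeasurable" "R \<in> sets lebesgue" "R \<subseteq> S" "ess_bounded S F"
    and "\<And>x. x \<in> R \<Longrightarrow> (k x)\<^sup>2 \<le> F x \<bullet> F x"
    and "k \<in> borel_measurable (lebesgue_on R)"
  shows "ip R k k \<le> ip S F (F::real^2 \<Rightarrow> 'a::euclidean_space)"
proof -
  have i: "integrable (lebesgue_on S) (\<lambda>x. F x \<bullet> F x)"
    by (intro ess_bounded_integrable_inner assms)
  have S: "S \<in> sets lebesgue"
    using assms(1) by (rule fmeasurableD)
  have i': "integrable lebesgue (\<lambda>x. indicator S x *\<^sub>R (F x \<bullet> F x))"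
    using i S by (subst (asm) integrable_restrict_space) auto
  have "(\<integral>x. indicator R x *\<^sub>R (k x \<bullet> k x) \<partial>lebesgue) \<le> (\<integral>x. indicator S x *\<^sub>R (F x \<bullet> F x) \<partial>lebesgue)"
    by (rule Bochner_Integration.integral_mono')
      (use i' assms in \<open>auto simp: indicator_def power2_eq_square\<close>)
  then show ?thesis
    unfolding ip_def using S assms(2) by (simp add: integral_restrict_space)
qed

text \<open>Lebesgue measure is complete, so every preimage inside a null set is measurable. This
  disposes of the values of derivatives on the edges.\<close>

lemma borel_measurable_lebesgue_on_negligible:
  fixes f :: "real^2 \<Rightarrow> 'a::euclidean_space"
  assumes "negligible N"
  shows "f \<in> borel_measurable (lebesgue_on N)"
proof (rule measurableI)
  fix A assume "A \<in> sets (borel::'a measure)"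
  have "negligible (f -` A \<inter> N)"
    using assms by (rule negligible_subset) auto
  then show "f -` A \<inter> space (lebesgue_on N) \<in> sets (lebesgue_on N)"
    using assms by (simp add: sets_restrict_space_iff negligible_imp_sets)
qed simp

text \<open>The minimum over the unit sphere, attained by compactness, is positive, and homogeneity
  of degree two carries it to all vectors.\<close>

lemma bilinear_posdef_lower_bound:
  fixes B :: "'a::euclidean_space \<Rightarrow> 'a \<Rightarrow> real"
  assumes "bilinear B" and pos: "\<And>x. x \<noteq> 0 \<Longrightarrow> 0 < B x x"
  shows "\<exists>m>0. \<forall>x. m * (norm x)\<^sup>2 \<le> B x x"
proof -
  have bb: "bounded_bilinear B"
    using assms(1) by (simp add: bilinear_conv_bounded_bilinear)
  have "continuous_on (sphere 0 1) (\<lambda>x. B x x)"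
    by (intro bounded_bilinear.continuous_on[OF bb] continuous_on_id)
  moreover have "(sphere 0 1 :: 'a set) \<noteq> {}"
    by simp
  ultimately obtain y where y: "y \<in> sphere 0 1" and min: "\<And>x. x \<in> sphere 0 1 \<Longrightarrow> B y y \<le> B x x"
    using continuous_attains_inf[of "sphere 0 1" "\<lambda>x. B x x"] by auto
  have "B y y * (norm x)\<^sup>2 \<le> B x x" for x
  proof (cases "x = 0")
    case True
    then show ?thesis using bounded_bilinear.zero_left[OF bb] by simp
  next
    case False
    have "B y y \<le> B (x /\<^sub>R norm x) (x /\<^sub>R norm x)"
      using False by (intro min) simp
    also have "\<dots> = B x x / (norm x)\<^sup>2"
      by (simp add: bounded_bilinear.scaleR_left[OF bb] bounded_bilinear.scaleR_right[OF bb]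
          power2_eq_square divide_simps)
    finally show ?thesis
      using False by (simp add: field_simps)
  qed
  moreover have "y \<noteq> 0"
    using y by auto
  ultimately show ?thesis
    using pos by blast
qed

text \<open>Compactness of the unit sphere of the coefficient space bounds the coefficients of an affine
  function by its L2 norm over an open set.\<close>
lemma affine_coeffs_tendsto_0:
  fixes l :: "nat \<Rightarrow> real^2 \<Rightarrow> real" and a b c :: "nat \<Rightarrow> real"
  assumes "open S" "S \<noteq> {}" "bounded S"
    and l: "\<And>i x. x \<in> S \<Longrightarrow> l i x = a i + b i * x$1 + c i * x$2"
    and lim: "(\<lambda>i. ip S (l i) (l i)) \<longlonglongrightarrow> 0"
  shows "a \<longlonglongrightarrow> 0" "b \<longlonglongrightarrow> 0" "c \<longlonglongrightarrow> 0"
proof -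
  \<comment> \<open>The three coefficients form one vector of a Euclidean space, so the L2 inner
    product of affine functions becomes a bilinear form to which the sphere argument
    applies.\<close>
  define L :: "real \<times> real \<times> real \<Rightarrow> real^2 \<Rightarrow> real"
    where "L d x = fst d + fst (snd d) * x$1 + snd (snd d) * x$2" for d x
  define B where "B d e = ip S (L d) (L e)" for d e
  have S: "S \<in> lmeasurable" "S \<in> sets lebesgue"
    using assms by (auto simp: bounded_set_imp_lmeasurable)
  have cont: "continuous_on X (L d)" for d X
    unfolding L_def by (intro continuous_intros)
  have eb: "ess_bounded S (L d)" for d
    using S assms(3) cont by (intro ess_bounded_continuous)
  have Ladd: "L (d + e) = (\<lambda>x. L d x + L e x)" and Lsc: "L (r *\<^sub>R d) = (\<lambda>x. r *\<^sub>R L d x)" for d e r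
    by (auto simp: L_def algebra_simps)
  have "bilinear B"
    unfolding bilinear_def
  proof (intro conjI allI linearI)
    show "B d (e + e') = B d e + B d e'" for d e e'
      unfolding B_def ip_commute[of S "L d"] Ladd by (intro ip_add_left S eb)
    show "B (e + e') d = B e d + B e' d" for d e e'
      unfolding B_def Ladd by (intro ip_add_left S eb)
    show "B d (r *\<^sub>R e) = r *\<^sub>R B d e" for d e r
      unfolding B_def ip_commute[of S "L d"] Lsc by (simp add: ip_scaleR_left[where 'a=real, simplified])
    show "B (r *\<^sub>R e) d = r *\<^sub>R B e d" for d e r
      unfolding B_def Lsc by (simp add: ip_scaleR_left[where 'a=real, simplified])
  qed
  moreover have "0 < B d d" if "d \<noteq> 0" for d
  proof (rule ccontr)
    assume "\<not> 0 < B d d"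
    then have "B d d = 0"
      using ip_nonneg[of S "L d"] by (simp add: B_def)
    then have "AE x in lebesgue_on S. L d x \<bullet> L d x = 0"
      unfolding B_def ip_def
      by (subst (asm) integral_nonneg_eq_0_iff_AE[OF ess_bounded_integrable_inner[OF S(1) eb eb]]) auto
    then have "AE x in lebesgue. x \<in> S \<longrightarrow> L d x = 0"
      using S by (simp add: AE_restrict_space_iff)
    then have "negligible {x \<in> S. L d x \<noteq> 0}"
      by (simp add: negligible_iff_null_sets completion.AE_iff_null_sets Collect_conj_eq)
    \<comment> \<open>A nonempty open set is not null, which upgrades vanishing almost everywhere on
      \<open>S\<close> to vanishing everywhere.\<close>
    moreover have "open {x \<in> S. L d x \<noteq> 0}"
      using open_Collect_neq[OF cont[of UNIV d] continuous_on_const[of UNIV 0]] \<open>open S\<close>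
      by (simp add: Collect_conj_eq open_Int)
    ultimately have z: "L d x = 0" if "x \<in> S" for x
      using that open_not_negligible by blast
    \<comment> \<open>A point and its shifts by \<open>r\<close> along the two axes are affinely
      independent, so the values there determine an affine function.\<close>
    obtain x0 r where r: "r > 0" "cball x0 r \<subseteq> S"
      using assms by (metis all_not_in_conv open_contains_cball)
    have "L d (x0 + r *\<^sub>R axis j 1) = 0" "L d x0 = 0" for j
      using r by (auto intro!: z subsetD[OF r(2)] simp: dist_norm)
    from this(1)[of 1] this(1)[of 2] this(2)
    have z: "fst d + fst (snd d) * (x0$1 + r) + snd (snd d) * x0$2 = 0"
        "fst d + fst (snd d) * x0$1 + snd (snd d) * (x0$2 + r) = 0"
        "fst d + fst (snd d) * x0$1 + snd (snd d) * x0$2 = 0"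
      by (simp_all add: L_def axis_def)
    then have "fst (snd d) * r = 0" "snd (snd d) * r = 0"
      by (simp_all only: distrib_left)
    with z have "d = 0"
      using r(1) by (auto simp: prod_eq_iff)
    with that show False by simp
  qed
  ultimately obtain m where m: "m > 0" "\<And>d. m * (norm d)\<^sup>2 \<le> B d d"
    using bilinear_posdef_lower_bound[of B] by blast
  define d where "d i = (a i, b i, c i)" for i
  have "B (d i) (d i) = ip S (l i) (l i)" for i
    unfolding B_def ip_def
    by (rule Bochner_Integration.integral_cong) (auto simp: L_def d_def l)
  then have le: "(norm (d i))\<^sup>2 \<le> ip S (l i) (l i) / m" for i
    using m by (metis mult.commute pos_le_divide_eq)
  have "(\<lambda>i. (norm (d i))\<^sup>2) \<longlonglongrightarrow> 0"
    by (rule tendsto_sandwich[OF _ _ tendsto_const tendsto_divide_zero[OF lim, of m]])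
      (use le in auto)
  from tendsto_real_sqrt[OF this] have "d \<longlonglongrightarrow> 0"
    by (simp add: tendsto_norm_zero_iff)
  from tendsto_fst[OF this] tendsto_fst[OF tendsto_snd[OF this]] tendsto_snd[OF tendsto_snd[OF this]]
  show "a \<longlonglongrightarrow> 0" "b \<longlonglongrightarrow> 0" "c \<longlonglongrightarrow> 0"
    by (simp_all add: d_def)
qed

section \<open>Conforming triangulations\<close>

lemma triangle_interior_nonempty:
  assumes "triangle K"
  shows "interior K \<noteq> {}"
proof -
  obtain a b c where "\<not> collinear {a, b, c}" "K = convex hull {a, b, c}"
    using assms by (auto simp: triangle_def)
  \<comment> \<open>The barycenter, whose three weights are all strictly positive.\<close>
  then have "(1/3) *\<^sub>R a + (1/3) *\<^sub>R b + (1/3) *\<^sub>R c \<in> interior K"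
    using interior_convex_hull_3_minimal[of a b c] by (force intro!: exI[of _ "1/3"])
  then show ?thesis by blast
qed

lemma triangle_compact: "triangle K \<Longrightarrow> compact K"
  by (auto simp: triangle_def intro!: finite_imp_compact_convex_hull)

lemma triangle_convex: "triangle K \<Longrightarrow> convex K"
  by (auto simp: triangle_def)

lemma finite_verts: "triangle K \<Longrightarrow> finite (verts K)"
  unfolding triangle_def verts_def
proof -
  assume "\<exists>a b c. \<not> collinear {a, b, c} \<and> K = convex hull {a, b, c}"
  then obtain a b c where "K = convex hull {a, b, c}"
    by blast
  then have "{x. x extreme_point_of K} \<subseteq> {a, b, c}"
    using extreme_point_of_convex_hull by blast
  then show "finite {x. x extreme_point_of K}"
    by (rule finite_subset) simp
qed

lemma verts_subset: "verts K \<subseteq> K"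
  by (auto simp: verts_def extreme_point_of_def)

context
  fixes \<Omega> :: "(real^2) set" and Th :: "(real^2) set set"
  assumes mesh: "triangulation \<Omega> Th"
begin

lemma mesh_finite: "finite Th"
  and mesh_triangle: "K \<in> Th \<Longrightarrow> triangle K"
  and domain_eq: "\<Omega> = interior (\<Union>Th)"
  and mesh_conforming: "K1 \<in> Th \<Longrightarrow> K2 \<in> Th \<Longrightarrow> K1 \<noteq> K2 \<Longrightarrow> K1 \<inter> K2 = convex hull (verts K1 \<inter> verts K2)"
  using mesh by (auto simp: triangulation_def)

lemma mesh_compact: "compact (\<Union>Th)"
  using mesh_finite mesh_triangle triangle_compact by (auto intro: compact_Union)

lemma closure_domain_subset: "closure \<Omega> \<subseteq> \<Union>Th"
  using mesh_compact by (metis closure_minimal compact_imp_closed domain_eq interior_subset)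

lemma open_domain: "open \<Omega>"
  by (simp add: domain_eq)

lemma bounded_domain: "bounded \<Omega>"
  using mesh_compact by (metis bounded_subset compact_imp_bounded domain_eq interior_subset)

lemma domain_lmeasurable: "\<Omega> \<in> lmeasurable"
  using open_domain bounded_domain by (simp add: bounded_set_imp_lmeasurable)

lemma interior_subset_domain: "K \<in> Th \<Longrightarrow> interior K \<subseteq> \<Omega>"
  unfolding domain_eq by (intro interior_mono) auto

text \<open>Two triangles meeting in a point other than a vertex share an edge, and the domain stays
  connected after removal of the finitely many vertices.\<close>
lemma mesh_edge_connected:
  assumes "connected \<Omega>" "G \<subseteq> Th" "G \<noteq> {}"
    and step: "\<And>K K' s t. K \<in> G \<Longrightarrow> K' \<in> Th \<Longrightarrow> s \<in> K \<inter> K' \<Longrightarrow> t \<in> K \<inter> K' \<Longrightarrow> s \<noteq> t \<Longrightarrow> K' \<in> G"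
  shows "G = Th"
proof (rule ccontr)
  assume "G \<noteq> Th"
  then obtain K2 where K2: "K2 \<in> Th - G" using assms(2) by auto
  obtain K1 where K1: "K1 \<in> G" using assms(3) by auto
  define V where "V = (\<Union>K\<in>Th. verts K)"
  have finV: "finite V"
    unfolding V_def using mesh_finite mesh_triangle finite_verts by auto
  have conn: "connected (\<Omega> - V)"
    using open_domain assms(1) finV by (intro connected_open_delete_finite) auto
  have cl: "closed (\<Union>H)" if "H \<subseteq> Th" for H
    using that mesh_finite mesh_triangle triangle_compact
    by (meson closed_Union compact_imp_closed finite_subset subsetD)
  \<comment> \<open>The interior of a triangle is infinite, so every triangle still meets the domain
    after the vertices are removed; neither of the two closed sets below is then empty
    there.\<close>
  have ne: "K \<inter> (\<Omega> - V) \<noteq> {}" if "K \<in> Th" for K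
  proof -
    have "infinite (interior K)"
      using triangle_interior_nonempty[OF mesh_triangle[OF that]] open_interior
      by (meson finite_imp_not_open)
    then obtain x where "x \<in> interior K" "x \<notin> V"
      using finV by (meson finite_subset subsetI)
    then show ?thesis
      using interior_subset_domain[OF that] interior_subset by blast
  qed
  have "\<Union>G \<inter> (\<Omega> - V) = {} \<or> \<Union>(Th - G) \<inter> (\<Omega> - V) = {}"
  proof (rule connected_closedD[OF conn])
    show "\<Union>G \<inter> \<Union>(Th - G) \<inter> (\<Omega> - V) = {}"
    proof (rule ccontr)
      assume "\<Union>G \<inter> \<Union>(Th - G) \<inter> (\<Omega> - V) \<noteq> {}"
      then obtain x K K' where x: "x \<in> K" "K \<in> G" "x \<in> K'" "K' \<in> Th - G" "x \<notin> V"
        by blast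
      let ?W = "verts K \<inter> verts K'"
      have xW: "x \<in> convex hull ?W"
        using x assms(2) mesh_conforming[of K K'] by blast
      have "\<not> (s \<in> ?W \<and> t \<in> ?W \<and> s \<noteq> t)" for s t
        using step[of K K' s t] x verts_subset[of K] verts_subset[of K'] by blast
      then consider "?W = {}" | s where "?W = {s}"
        by (metis insertI1 is_singletonI' is_singleton_the_elem)
      \<comment> \<open>The hull of at most one vertex contains nothing but that vertex, so
        \<open>x\<close> would be one of the removed points.\<close>
      then have "x \<in> ?W"
        using xW by cases simp_all
      then show False
        using x assms(2) by (auto simp: V_def)
    qed
    show "\<Omega> - V \<subseteq> \<Union>G \<union> \<Union>(Th - G)"
      using assms(2) closure_domain_subset closure_subset by blast
  qed (use cl assms(2) in auto)
  then show False
    using ne[of K1] ne[of K2] K1 K2 assms(2) by blast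
qed

text \<open>The assumption \<open>local\<close> speaks of two distinct points because an
  infinitesimal rigid motion that vanishes at one point may still rotate about it. A boundary
  segment supplies two such points for a first triangle, a common edge supplies them for each
  neighbour.\<close>

lemma uniform_limit_mesh:
  fixes e :: "nat \<Rightarrow> real^2 \<Rightarrow> 'b::real_normed_vector"
  assumes "connected \<Omega>"
    and seg: "\<exists>a b. a \<noteq> b \<and> closed_segment a b \<subseteq> \<Gamma>" "\<Gamma> \<subseteq> frontier \<Omega>"
    and zero: "\<And>i x. x \<in> \<Gamma> \<Longrightarrow> e i x = 0"
    and local: "\<And>K s t. K \<in> Th \<Longrightarrow> s \<in> K \<Longrightarrow> t \<in> K \<Longrightarrow> s \<noteq> t \<Longrightarrow> (\<lambda>i. e i s) \<longlonglongrightarrow> 0 \<Longrightarrow>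
        (\<lambda>i. e i t) \<longlonglongrightarrow> 0 \<Longrightarrow> uniform_limit K e (\<lambda>_. 0) sequentially"
  shows "uniform_limit (closure \<Omega>) e (\<lambda>_. 0) sequentially"
proof -
  define G where "G = {K \<in> Th. uniform_limit K e (\<lambda>_. 0) sequentially}"
  obtain a b where ab: "a \<noteq> b" "closed_segment a b \<subseteq> \<Gamma>"
    using seg by auto
  have "closed_segment a b \<subseteq> \<Union>Th"
    using ab seg(2) closure_domain_subset by (auto simp: frontier_def)
  \<comment> \<open>Pigeonhole: an infinite segment covered by finitely many triangles meets one of
    them in infinitely many points, from which \<open>s\<close> and \<open>t\<close> are
    picked.\<close>
  then have "closed_segment a b = (\<Union>K\<in>Th. closed_segment a b \<inter> K)"
    by blast
  moreover have "infinite (closed_segment a b)"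
    using ab by simp
  ultimately obtain K0 where K0: "K0 \<in> Th" "infinite (closed_segment a b \<inter> K0)"
    using mesh_finite by (metis finite_UN)
  then obtain s where s: "s \<in> closed_segment a b \<inter> K0"
    using infinite_imp_nonempty by blast
  obtain t where t: "t \<in> closed_segment a b \<inter> K0" "t \<noteq> s"
    using infinite_imp_nonempty[OF infinite_remove[OF K0(2), of s]] by blast
  have "K0 \<in> G"
  proof -
    have "e i s = 0" "e i t = 0" for i
      using s t ab(2) zero by auto
    then show ?thesis
      using K0(1) local[of K0 s t] s t by (simp add: G_def)
  qed
  moreover have "K' \<in> G" if "K \<in> G" "K' \<in> Th" "s \<in> K \<inter> K'" "t \<in> K \<inter> K'" "s \<noteq> t" for K K' s t
    using that local[of K' s t] tendsto_uniform_limitI[where S=K and l="\<lambda>_. 0"]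
    by (auto simp: G_def)
  ultimately have "G = Th"
    using mesh_edge_connected[OF assms(1), of G] by (auto simp: G_def)
  then have "uniform_limit (\<Union>Th) e (\<lambda>_. 0) sequentially"
    using mesh_finite by (intro uniform_limit_on_Union) (auto simp: G_def)
  then show ?thesis
    using closure_domain_subset by (rule uniform_limit_on_subset)
qed

section \<open>The null set of edges and piecewise continuous functions\<close>

lemma negligible_skeleton: "negligible (\<Union>K\<in>Th. frontier K)"
proof (rule negligible_Union)
  show "finite (frontier ` Th)"
    using mesh_finite by simp
  show "negligible t" if "t \<in> frontier ` Th" for t
    using that mesh_triangle triangle_convex negligible_convex_frontier by blast
qed

lemma domain_subset_interiors_skeleton: "\<Omega> \<subseteq> (\<Union>K\<in>Th. interior K) \<union> (\<Union>K\<in>Th. frontier K)"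
proof
  fix x assume "x \<in> \<Omega>"
  then obtain K where "K \<in> Th" "x \<in> K"
    using closure_domain_subset closure_subset by blast
  then show "x \<in> (\<Union>K\<in>Th. interior K) \<union> (\<Union>K\<in>Th. frontier K)"
    using closure_subset[of K] by (cases "x \<in> interior K") (auto simp: frontier_def)
qed

text \<open>Reduces almost-everywhere identities between derivatives to points around which the
  discrete functions are polynomials.\<close>

lemma AE_interior: "AE x in lebesgue_on \<Omega>. \<exists>K\<in>Th. x \<in> interior K"
proof -
  have "AE x in lebesgue. x \<notin> (\<Union>K\<in>Th. frontier K)"
    using negligible_skeleton by (intro AE_not_in) (simp add: negligible_iff_null_sets)
  then have "AE x in lebesgue. x \<in> \<Omega> \<longrightarrow> (\<exists>K\<in>Th. x \<in> interior K)"
    by eventually_elim (use domain_subset_interiors_skeleton in blast)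
  then show ?thesis
    using domain_lmeasurable by (simp add: AE_restrict_space_iff fmeasurableD)
qed

text \<open>The skeleton is a null set, so the values of \<open>f\<close> there affect neither
  measurability nor the essential bound. The pieces are continuous on the whole plane, hence bounded
  on the compact closed triangle and not merely finite on its interior.\<close>

lemma ess_bounded_piecewise_continuous:
  fixes f :: "real^2 \<Rightarrow> 'a::euclidean_space"
  assumes "\<And>K. K \<in> Th \<Longrightarrow> \<exists>p. continuous_on UNIV p \<and> (\<forall>x\<in>interior K. f x = p x)"
  shows "ess_bounded \<Omega> f"
proof -
  let ?N = "\<Union>K\<in>Th. frontier K"
  have \<Omega>: "\<Omega> \<in> sets lebesgue"
    using domain_lmeasurable by (rule fmeasurableD)
  have N: "?N \<in> sets lebesgue"
    using negligible_skeleton by (rule negligible_imp_sets)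
  have "f \<in> borel_measurable (lebesgue_on \<Omega>)"
  proof (rule measurable_piecewise_restrict[of "insert ?N (interior ` Th)"])
    show "countable (insert ?N (interior ` Th))"
      using mesh_finite by (simp add: countable_finite)
    show "space (lebesgue_on \<Omega>) \<subseteq> \<Union> (insert ?N (interior ` Th))"
      using domain_subset_interiors_skeleton by auto
    fix A assume A: "A \<in> insert ?N (interior ` Th)"
    then have A': "A \<in> sets lebesgue"
      using N by auto
    then show "A \<inter> space (lebesgue_on \<Omega>) \<in> sets (lebesgue_on \<Omega>)"
      using \<Omega> by (auto simp: sets_restrict_space_iff)
    have r: "restrict_space (lebesgue_on \<Omega>) A = lebesgue_on (\<Omega> \<inter> A)"
      using \<Omega> A' by (intro restrict_restrict_space) auto
    show "f \<in> borel_measurable (restrict_space (lebesgue_on \<Omega>) A)"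
    proof (cases "A = ?N")
      case True
      have "negligible (\<Omega> \<inter> A)"
        using negligible_skeleton True by (metis inf_le2 negligible_subset)
      then show ?thesis
        unfolding r by (rule borel_measurable_lebesgue_on_negligible)
    next
      case False
      then obtain K p where K: "A = interior K" "K \<in> Th" "continuous_on UNIV p" "\<forall>x\<in>interior K. f x = p x"
        using A assms by blast
      then have "p \<in> borel_measurable (lebesgue_on (\<Omega> \<inter> A))"
        using \<Omega> A' by (intro continuous_imp_measurable_on_sets_lebesgue)
          (auto intro: continuous_on_subset)
      then show ?thesis
        unfolding r using K by (subst measurable_cong[where g=p]) auto
    qed
  qed
  moreover have "\<exists>B. AE x in lebesgue_on \<Omega>. norm (f x) \<le> B"
  proof -
    have "bounded (\<Union>K\<in>Th. f ` interior K)"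
    proof (rule bounded_UN[OF mesh_finite], rule ballI)
      fix K assume K: "K \<in> Th"
      then obtain p where p: "continuous_on UNIV p" "\<forall>x\<in>interior K. f x = p x"
        using assms by blast
      have "compact (p ` K)"
        using p(1) K mesh_triangle triangle_compact
        by (blast intro: compact_continuous_image continuous_on_subset)
      then have "bounded (p ` interior K)"
        by (meson bounded_subset compact_imp_bounded image_mono interior_subset)
      moreover have "f ` interior K = p ` interior K"
        using p(2) by auto
      ultimately show "bounded (f ` interior K)"
        by simp
    qed
    then obtain B where B: "\<And>K x. K \<in> Th \<Longrightarrow> x \<in> interior K \<Longrightarrow> norm (f x) \<le> B"
      unfolding bounded_iff by blast
    have "AE x in lebesgue_on \<Omega>. norm (f x) \<le> B"
      using AE_interior by eventually_elim (use B in blast)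
    then show ?thesis by blast
  qed
  ultimately show ?thesis
    by (simp add: ess_bounded_def)
qed

end

section \<open>Piecewise quadratic functions\<close>

text \<open>The double sum of \<open>Pk 2\<close> written out, \<open>c a b\<close> being the
  coefficient of \<open>(x$1)^a * (x$2)^b\<close>. Affine functions are the case of vanishing
  second-order coefficients, so one derivative formula serves all the spaces.\<close>

definition quad :: "(nat \<Rightarrow> nat \<Rightarrow> real) \<Rightarrow> real^2 \<Rightarrow> real" where
  "quad c x = c 0 0 + c 0 1 * x$2 + c 0 2 * (x$2)\<^sup>2 + c 1 0 * x$1 + c 1 1 * (x$1 * x$2)
     + c 2 0 * (x$1)\<^sup>2"

lemma Pk2_quad: "Pk 2 p \<Longrightarrow> \<exists>c. \<forall>x. p x = quad c x"
proof -
  assume "Pk 2 p"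
  then obtain c where "\<And>x. p x = (\<Sum>a\<le>2. \<Sum>b\<le>2 - a. c a b * (x$1)^a * (x$2)^b)"
    unfolding Pk_def by blast
  then have "\<forall>x. p x = quad c x"
    by (simp add: quad_def numeral_2_eq_2)
  then show ?thesis by blast
qed

lemma Pk1_quad: "Pk 1 p \<Longrightarrow> \<exists>c. (\<forall>x. p x = quad c x) \<and> c 0 2 = 0 \<and> c 1 1 = 0 \<and> c 2 0 = 0"
proof -
  assume "Pk 1 p"
  then obtain c where c: "\<And>x. p x = (\<Sum>a\<le>1. \<Sum>b\<le>1 - a. c a b * (x$1)^a * (x$2)^b)"
    unfolding Pk_def by blast
  \<comment> \<open>\<open>c\<close> is arbitrary at indices outside the range of the sum; it is cut
    off at total degree one so that the second-order coefficients really vanish.\<close>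
  define d where "d a b = (if a + b \<le> 1 then c a b else 0)" for a b :: nat
  have "\<forall>x. p x = quad d x"
    unfolding c quad_def d_def by simp
  then show ?thesis
    by (intro exI[of _ d]) (simp add: d_def)
qed

lemma Pk_diff:
  assumes "Pk k p" "Pk k q"
  shows "Pk k (\<lambda>x. p x - q x)"
proof -
  obtain c where "\<And>x. p x = (\<Sum>a\<le>k. \<Sum>b\<le>k - a. c a b * (x$1)^a * (x$2)^b)"
    using assms(1) unfolding Pk_def by blast
  moreover obtain d where "\<And>x. q x = (\<Sum>a\<le>k. \<Sum>b\<le>k - a. d a b * (x$1)^a * (x$2)^b)"
    using assms(2) unfolding Pk_def by blast
  ultimately show ?thesis
    unfolding Pk_def
    by (intro exI[of _ "\<lambda>a b. c a b - d a b"]) (simp add: sum_subtractf left_diff_distrib)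
qed

lemma continuous_on_quad: "continuous_on S (quad c)"
  unfolding quad_def by (intro continuous_intros)

lemma has_derivative_quad:
  "(quad c has_derivative (\<lambda>h. (c 1 0 + c 1 1 * x$2 + 2 * c 2 0 * x$1) * h$1
      + (c 0 1 + c 1 1 * x$1 + 2 * c 0 2 * x$2) * h$2)) (at x)"
proof -
  note [derivative_intros] = bounded_linear.has_derivative[OF bounded_linear_vec_nth]
  show ?thesis
    unfolding quad_def power2_eq_square
    by (rule has_derivative_eq_rhs, (rule derivative_intros)+) (simp add: fun_eq_iff algebra_simps)
qed

lemma pd_eq:
  assumes "(f has_derivative f') (at x)"
  shows "pd f j x = f' (axis j 1)"
  using assms frechet_derivative_at[OF assms] by (auto simp: pd_def differentiable_def)

lemma pd_diff:
  assumes "f differentiable (at x)" "g differentiable (at x)"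
  shows "pd (\<lambda>y. f y - g y) j x = pd f j x - pd g j x"
proof -
  note d = assms[THEN frechet_derivative_works[THEN iffD1]]
  show ?thesis
    unfolding pd_eq[OF has_derivative_diff[OF d]] pd_eq[OF d(1)] pd_eq[OF d(2)] ..
qed

text \<open>Differentiation is local, so inside the triangle \<open>q\<close> may be replaced by its
  polynomial. The summands are ordered as constant, \<open>x$1\<close>, \<open>x$2\<close> to match
  the affine functions whose coefficients are estimated.\<close>

lemma
  assumes "\<And>y. y \<in> K \<Longrightarrow> q y = quad c y" "x \<in> interior K"
  shows differentiable_on_quad_piece: "q differentiable (at x)"
    and pd_quad_1: "pd q 1 x = c 1 0 + 2 * c 2 0 * x$1 + c 1 1 * x$2"
    and pd_quad_2: "pd q 2 x = c 0 1 + c 1 1 * x$1 + 2 * c 0 2 * x$2"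
proof -
  have d: "(q has_derivative (\<lambda>h. (c 1 0 + c 1 1 * x$2 + 2 * c 2 0 * x$1) * h$1
      + (c 0 1 + c 1 1 * x$1 + 2 * c 0 2 * x$2) * h$2)) (at x)"
    by (rule has_derivative_transform_within_open[OF has_derivative_quad open_interior assms(2)])
      (metis assms(1) interior_subset subsetD)
  then show "q differentiable (at x)"
    by (auto simp: differentiable_def)
  show "pd q 1 x = c 1 0 + 2 * c 2 0 * x$1 + c 1 1 * x$2"
    "pd q 2 x = c 0 1 + c 1 1 * x$1 + 2 * c 0 2 * x$2"
    by (simp_all add: pd_eq[OF d] axis_def)
qed

lemma differentiable_vecI:
  fixes v :: "real^2 \<Rightarrow> real^2"
  assumes "\<And>j. (\<lambda>y. v y $ j) differentiable (at x)"
  shows "v differentiable (at x)"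
  unfolding differentiable_componentwise_within[of v]
proof
  fix i :: "real^2" assume "i \<in> Basis"
  then obtain j where "i = axis j 1"
    by (auto simp: Basis_vec_def)
  then show "(\<lambda>y. v y \<bullet> i) differentiable (at x)"
    using assms[of j] by (simp add: inner_axis)
qed

text \<open>Differentiability is asked of the whole vector: if another component fails,
  \<open>pd v\<close> takes its default value 0 while the derivative of this component may be
  nonzero.\<close>

lemma pd_component:
  fixes v :: "real^2 \<Rightarrow> real^2"
  assumes "v differentiable (at x)"
  shows "pd v k x $ j = pd (\<lambda>y. v y $ j) k x"
proof -
  note d = assms[THEN frechet_derivative_works[THEN iffD1]]
  show ?thesis
    unfolding pd_eq[OF d] pd_eq[OF bounded_linear.has_derivative[OF bounded_linear_vec_nth d]] ..
qed

text \<open>A common roof for \<open>Qh\<close> and the components of \<open>Vh\<close>, keeping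
  only what derivatives inside triangles depend on.\<close>

definition piecewise_quad :: "(real^2) set set \<Rightarrow> (real^2 \<Rightarrow> real) \<Rightarrow> bool" where
  "piecewise_quad Th q \<longleftrightarrow> (\<forall>K\<in>Th. \<exists>c. \<forall>x\<in>K. q x = quad c x)"

lemma QhD: "q \<in> Qh \<Omega> Th \<Longrightarrow> K \<in> Th \<Longrightarrow> \<exists>p. Pk 1 p \<and> (\<forall>x\<in>K. q x = p x)"
  by (simp add: Qh_def)

lemma VhD: "v \<in> Vh \<Omega> Th \<Gamma> \<Longrightarrow> K \<in> Th \<Longrightarrow> \<exists>p. Pk 2 p \<and> (\<forall>x\<in>K. v x $ j = p x)"
  by (simp add: Vh_def)

lemma Qh_piecewise_quad: "q \<in> Qh \<Omega> Th \<Longrightarrow> piecewise_quad Th q"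
  unfolding piecewise_quad_def
proof
  fix K assume "q \<in> Qh \<Omega> Th" "K \<in> Th"
  then obtain p where "Pk 1 p" "\<forall>x\<in>K. q x = p x"
    using QhD by blast
  then show "\<exists>c. \<forall>x\<in>K. q x = quad c x"
    using Pk1_quad[of p] by auto
qed

lemma Vh_piecewise_quad: "v \<in> Vh \<Omega> Th \<Gamma> \<Longrightarrow> piecewise_quad Th (\<lambda>x. v x $ j)"
  unfolding piecewise_quad_def
proof
  fix K assume "v \<in> Vh \<Omega> Th \<Gamma>" "K \<in> Th"
  then obtain p where "Pk 2 p" "\<forall>x\<in>K. v x $ j = p x"
    using VhD by blast
  then show "\<exists>c. \<forall>x\<in>K. v x $ j = quad c x"
    using Pk2_quad[of p] by auto
qed

lemma Wh_subset_Qh: "q \<in> Wh \<Omega> Th \<Longrightarrow> q \<in> Qh \<Omega> Th"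
  by (simp add: Wh_def)

lemma Qh_diff:
  assumes "p \<in> Qh \<Omega> Th" "q \<in> Qh \<Omega> Th"
  shows "(\<lambda>x. p x - q x) \<in> Qh \<Omega> Th"
proof -
  have "\<exists>r. Pk 1 r \<and> (\<forall>x\<in>K. p x - q x = r x)" if K: "K \<in> Th" for K
  proof -
    obtain p' where "Pk 1 p'" "\<forall>x\<in>K. p x = p' x"
      using QhD[OF assms(1) K] by blast
    moreover obtain q' where "Pk 1 q'" "\<forall>x\<in>K. q x = q' x"
      using QhD[OF assms(2) K] by blast
    ultimately show ?thesis
      by (intro exI[of _ "\<lambda>x. p' x - q' x"]) (simp add: Pk_diff)
  qed
  then show ?thesis
    using assms by (auto simp: Qh_def intro: continuous_on_diff)
qed

lemma Wh_diff: "p \<in> Wh \<Omega> Th \<Longrightarrow> q \<in> Wh \<Omega> Th \<Longrightarrow> (\<lambda>x. p x - q x) \<in> Wh \<Omega> Th"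
  by (simp add: Wh_def Qh_diff)

lemma Vh_diff:
  assumes "v \<in> Vh \<Omega> Th \<Gamma>" "w \<in> Vh \<Omega> Th \<Gamma>"
  shows "(\<lambda>x. v x - w x) \<in> Vh \<Omega> Th \<Gamma>"
proof -
  have "\<exists>r. Pk 2 r \<and> (\<forall>x\<in>K. (v x - w x) $ j = r x)" if K: "K \<in> Th" for K j
  proof -
    obtain p' where "Pk 2 p'" "\<forall>x\<in>K. v x $ j = p' x"
      using VhD[OF assms(1) K] by blast
    moreover obtain q' where "Pk 2 q'" "\<forall>x\<in>K. w x $ j = q' x"
      using VhD[OF assms(2) K] by blast
    ultimately show ?thesis
      by (intro exI[of _ "\<lambda>x. p' x - q' x"]) (simp add: Pk_diff)
  qed
  then show ?thesis
    using assms by (auto simp: Vh_def intro: continuous_on_diff)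
qed

lemma piecewise_quad_differentiable:
  assumes "piecewise_quad Th q" "K \<in> Th" "x \<in> interior K"
  shows "q differentiable (at x)"
proof -
  obtain c where "\<And>y. y \<in> K \<Longrightarrow> q y = quad c y"
    using assms(1,2) unfolding piecewise_quad_def by blast
  then show ?thesis
    using assms(3) by (rule differentiable_on_quad_piece)
qed

lemma piecewise_quad_pd:
  assumes "piecewise_quad Th q" "K \<in> Th"
  shows "\<exists>d. continuous_on UNIV d \<and> (\<forall>x\<in>interior K. pd q j x = d x)"
proof -
  obtain c where c: "\<And>x. x \<in> K \<Longrightarrow> q x = quad c x"
    using assms unfolding piecewise_quad_def by blast
  consider "j = 1" | "j = 2" using exhaust_2[of j] by blast
  then show ?thesis
  proof cases
    case 1
    then show ?thesis
      using pd_quad_1[OF c]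
      by (intro exI[of _ "\<lambda>x. c 1 0 + 2 * c 2 0 * x$1 + c 1 1 * x$2"])
        (auto intro!: continuous_intros)
  next
    case 2
    then show ?thesis
      using pd_quad_2[OF c]
      by (intro exI[of _ "\<lambda>x. c 0 1 + c 1 1 * x$1 + 2 * c 0 2 * x$2"])
        (auto intro!: continuous_intros)
  qed
qed

lemma epsm_component: "epsm v x $ i $ j = (pd v j x $ i + pd v i x $ j) / 2"
  by (simp add: epsm_def jac_def transpose_def)

lemma component_square_le_inner:
  fixes M :: "real^2^2" and z :: "real^2"
  shows "(z $ j)\<^sup>2 \<le> z \<bullet> z" "(M $ i $ j)\<^sup>2 \<le> M \<bullet> M"
proof -
  show *: "(z $ j)\<^sup>2 \<le> z \<bullet> z" for z :: "real^2"
    using power_mono[OF component_le_norm_cart[of z j] abs_ge_zero, of 2] by (simp add: dot_square_norm)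
  have "(M $ i $ j)\<^sup>2 \<le> M $ i \<bullet> M $ i"
    by (rule *)
  also have "\<dots> \<le> M \<bullet> M"
    unfolding inner_vec_def[of M M] by (rule member_le_sum) auto
  finally show "(M $ i $ j)\<^sup>2 \<le> M \<bullet> M" .
qed

lemma uniform_limit_quad:
  assumes "bounded K" and e: "\<And>i x. x \<in> K \<Longrightarrow> e i x = quad (c i) x"
    and "(\<lambda>i. c i 0 0) \<longlonglongrightarrow> 0" "(\<lambda>i. c i 0 1) \<longlonglongrightarrow> 0" "(\<lambda>i. c i 0 2) \<longlonglongrightarrow> 0"
      "(\<lambda>i. c i 1 0) \<longlonglongrightarrow> 0" "(\<lambda>i. c i 1 1) \<longlonglongrightarrow> 0" "(\<lambda>i. c i 2 0) \<longlonglongrightarrow> 0"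
  shows "uniform_limit K e (\<lambda>_. 0) sequentially"
proof -
  obtain R where R: "\<And>x. x \<in> K \<Longrightarrow> norm x \<le> R"
    using assms(1) by (auto simp: bounded_iff)
  \<comment> \<open>The triangle inequality taken monomial by monomial, with each coordinate
    replaced by its bound \<open>R\<close>; the result no longer depends on
    \<open>x\<close>.\<close>
  define s where "s i = \<bar>c i 0 0\<bar> + \<bar>c i 0 1\<bar> * R + \<bar>c i 0 2\<bar> * R\<^sup>2 + \<bar>c i 1 0\<bar> * R
    + \<bar>c i 1 1\<bar> * (R * R) + \<bar>c i 2 0\<bar> * R\<^sup>2" for i
  have "s \<longlonglongrightarrow> \<bar>0\<bar> + \<bar>0\<bar> * R + \<bar>0\<bar> * R\<^sup>2 + \<bar>0\<bar> * R + \<bar>0\<bar> * (R * R) + \<bar>0\<bar> * R\<^sup>2"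
    unfolding s_def by (intro tendsto_intros assms)
  then have s0: "s \<longlonglongrightarrow> 0" by simp
  have le: "norm (e i x) \<le> s i" if "x \<in> K" for i x
  proof -
    have x: "\<bar>x $ j\<bar> \<le> R" for j
      using R[OF that] component_le_norm_cart[of x j] by simp
    have R0: "0 \<le> R" using x[of 1] by simp
    have "norm (e i x) \<le> \<bar>c i 0 0\<bar> + \<bar>c i 0 1\<bar> * \<bar>x$2\<bar> + \<bar>c i 0 2\<bar> * \<bar>x$2\<bar>\<^sup>2 + \<bar>c i 1 0\<bar> * \<bar>x$1\<bar>
      + \<bar>c i 1 1\<bar> * (\<bar>x$1\<bar> * \<bar>x$2\<bar>) + \<bar>c i 2 0\<bar> * \<bar>x$1\<bar>\<^sup>2"
      unfolding e[OF that] quad_def real_norm_def power2_eq_square abs_mult[symmetric]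
      by linarith
    also have "\<dots> \<le> s i"
      unfolding s_def by (intro add_mono mult_left_mono mult_mono power_mono x order_refl R0) auto
    finally show ?thesis .
  qed
  show ?thesis
  proof (rule uniform_limitI)
    fix \<epsilon> :: real assume "0 < \<epsilon>"
    then have "\<forall>\<^sub>F i in sequentially. s i < \<epsilon>"
      using s0 by (rule order_tendstoD(2)[rotated])
    then show "\<forall>\<^sub>F i in sequentially. \<forall>x\<in>K. dist (e i x) 0 < \<epsilon>"
      by eventually_elim (use le in \<open>auto intro: le_less_trans\<close>)
  qed
qed

lemma uniform_limit_vec_0:
  fixes e :: "nat \<Rightarrow> real^2 \<Rightarrow> real^2"
  assumes "\<And>j. uniform_limit K (\<lambda>i x. e i x $ j) (\<lambda>_. 0) sequentially"
  shows "uniform_limit K e (\<lambda>_. 0) sequentially"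
proof (rule uniform_limitI)
  fix \<epsilon> :: real assume "0 < \<epsilon>"
  then have *: "\<forall>\<^sub>F i in sequentially. \<forall>x\<in>K. dist (e i x $ j) 0 < \<epsilon> / 2" for j
    by (intro uniform_limitD[OF assms]) simp
  show "\<forall>\<^sub>F i in sequentially. \<forall>x\<in>K. dist (e i x) 0 < \<epsilon>"
    using *[of 1] *[of 2]
  proof eventually_elim
    case (elim i)
    show ?case
    proof
      fix x assume "x \<in> K"
      have "norm (e i x) \<le> \<bar>e i x $ 1\<bar> + \<bar>e i x $ 2\<bar>"
        using norm_le_l1_cart[of "e i x"] by (simp add: sum_2)
      then show "dist (e i x) 0 < \<epsilon>"
        using elim \<open>x \<in> K\<close> by fastforce
    qed
  qed
qed

section \<open>Finite element functions and their derivatives over a mesh\<close>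

context
  fixes \<Omega> :: "(real^2) set" and Th :: "(real^2) set set"
  assumes mesh: "triangulation \<Omega> Th"
begin

lemma ess_bounded_piecewise_quad:
  assumes "piecewise_quad Th q"
  shows "ess_bounded \<Omega> q"
proof (rule ess_bounded_piecewise_continuous[OF mesh])
  fix K assume "K \<in> Th"
  then obtain c where "\<forall>x\<in>K. q x = quad c x"
    using assms unfolding piecewise_quad_def by blast
  then show "\<exists>p. continuous_on UNIV p \<and> (\<forall>x\<in>interior K. q x = p x)"
    using continuous_on_quad interior_subset by blast
qed

lemma ess_bounded_grad:
  assumes "piecewise_quad Th q"
  shows "ess_bounded \<Omega> (grad q)"
proof (rule ess_bounded_piecewise_continuous[OF mesh])
  fix K assume "K \<in> Th"
  then obtain d where "\<And>j. continuous_on UNIV (d j)" "\<And>j x. x \<in> interior K \<Longrightarrow> pd q j x = d j x"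
    using piecewise_quad_pd[OF assms] by metis
  then show "\<exists>p. continuous_on UNIV p \<and> (\<forall>x\<in>interior K. grad q x = p x)"
    by (intro exI[of _ "\<lambda>x. \<chi> j. d j x"]) (auto simp: grad_def intro!: continuous_on_vec_lambda)
qed

lemma Vh_differentiable:
  assumes "v \<in> Vh \<Omega> Th \<Gamma>" "K \<in> Th" "x \<in> interior K"
  shows "v differentiable (at x)"
  using assms by (intro differentiable_vecI piecewise_quad_differentiable[OF Vh_piecewise_quad])

lemma Vh_pd:
  assumes "v \<in> Vh \<Omega> Th \<Gamma>" "K \<in> Th"
  shows "\<exists>d. (\<forall>i j. continuous_on UNIV (d i j)) \<and> (\<forall>i j. \<forall>x\<in>interior K. pd v j x $ i = d i j x)"
proof -
  have "\<exists>d. continuous_on UNIV d \<and> (\<forall>x\<in>interior K. pd (\<lambda>y. v y $ i) j x = d x)" for i j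
    using assms by (intro piecewise_quad_pd Vh_piecewise_quad)
  then obtain d where "\<And>i j. continuous_on UNIV (d i j)"
    "\<And>i j x. x \<in> interior K \<Longrightarrow> pd (\<lambda>y. v y $ i) j x = d i j x"
    by metis
  then show ?thesis
    using pd_component[OF Vh_differentiable[OF assms]] by (intro exI[of _ d]) auto
qed

lemma ess_bounded_Vh:
  assumes "v \<in> Vh \<Omega> Th \<Gamma>"
  shows "ess_bounded \<Omega> (epsm v)" "ess_bounded \<Omega> (divg v)"
proof -
  show "ess_bounded \<Omega> (epsm v)"
  proof (rule ess_bounded_piecewise_continuous[OF mesh])
    fix K assume "K \<in> Th"
    then obtain d where "\<And>i j. continuous_on UNIV (d i j)"
      "\<And>i j x. x \<in> interior K \<Longrightarrow> pd v j x $ i = d i j x"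
      using Vh_pd[OF assms] by blast
    then show "\<exists>p. continuous_on UNIV p \<and> (\<forall>x\<in>interior K. epsm v x = p x)"
      by (intro exI[of _ "\<lambda>x. \<chi> i j. (d i j x + d j i x) / 2"])
        (auto simp: vec_eq_iff epsm_component intro!: continuous_on_vec_lambda continuous_intros)
  qed
  show "ess_bounded \<Omega> (divg v)"
  proof (rule ess_bounded_piecewise_continuous[OF mesh])
    fix K assume "K \<in> Th"
    then obtain d where "\<And>i j. continuous_on UNIV (d i j)"
      "\<And>i j x. x \<in> interior K \<Longrightarrow> pd v j x $ i = d i j x"
      using Vh_pd[OF assms] by blast
    then show "\<exists>p. continuous_on UNIV p \<and> (\<forall>x\<in>interior K. divg v x = p x)"
      by (intro exI[of _ "\<lambda>x. d 1 1 x + d 2 2 x"]) (auto simp: divg_def intro!: continuous_intros)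
  qed
qed

text \<open>Measurability goes through components, since \<open>A\<close> is given as measurable
  entrywise; the upper bound on \<open>A\<close> multiplies the essential bound by
  \<open>M\<close>.\<close>

lemma ess_bounded_spd_mult:
  assumes "spd_field \<Omega> A m M" "0 < M" "ess_bounded \<Omega> F"
  shows "ess_bounded \<Omega> (\<lambda>x. A x *v F x)"
proof -
  have F: "F \<in> borel_measurable (lebesgue_on \<Omega>)"
    using assms(3) by (simp add: ess_bounded_def)
  have A: "(\<lambda>x. A x $ i $ j) \<in> borel_measurable (lebesgue_on \<Omega>)" for i j
    using assms(1) by (simp add: spd_field_def)
  have "(\<lambda>x. (A x *v F x) \<bullet> b) \<in> borel_measurable (lebesgue_on \<Omega>)" if b: "b \<in> Basis" for b
  proof -
    obtain i where i: "b = axis i 1"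
      using b unfolding Basis_vec_def Basis_real_def by blast
    have "(\<lambda>x. F x \<bullet> axis j 1) \<in> borel_measurable (lebesgue_on \<Omega>)" for j
      using F by simp
    then have "(\<lambda>x. F x $ j) \<in> borel_measurable (lebesgue_on \<Omega>)" for j
      by (simp add: inner_axis)
    then have "(\<lambda>x. \<Sum>j\<in>UNIV. A x $ i $ j * F x $ j) \<in> borel_measurable (lebesgue_on \<Omega>)"
      using A by simp
    then show ?thesis
      by (simp add: i inner_axis matrix_vector_mult_def)
  qed
  then have "(\<lambda>x. A x *v F x) \<in> borel_measurable (lebesgue_on \<Omega>)"
    by (subst borel_measurable_euclidean_space) blast
  moreover obtain B where "AE x in lebesgue_on \<Omega>. norm (F x) \<le> B"
    using assms(3) by (auto simp: ess_bounded_def)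
  then have "AE x in lebesgue_on \<Omega>. norm (A x *v F x) \<le> M * B"
  proof (rule AE_mp, intro AE_I2 impI)
    fix x assume x: "x \<in> space (lebesgue_on \<Omega>)" "norm (F x) \<le> B"
    then have "norm (A x *v F x) \<le> M * norm (F x)"
      using assms(1) by (auto simp: spd_field_def)
    also have "\<dots> \<le> M * B"
      using x assms(2) by simp
    finally show "norm (A x *v F x) \<le> M * B" .
  qed
  ultimately show ?thesis
    by (auto simp: ess_bounded_def)
qed

lemma ip_spd_ge:
  assumes "spd_field \<Omega> A m M" "0 < M" "ess_bounded \<Omega> F"
  shows "m * ip \<Omega> F F \<le> ip \<Omega> (\<lambda>x. A x *v F x) F"
proof -
  have "(\<integral>x. m * (F x \<bullet> F x) \<partial>lebesgue_on \<Omega>) \<le> (\<integral>x. (A x *v F x) \<bullet> F x \<partial>lebesgue_on \<Omega>)"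
  proof (rule integral_mono)
    show "m * (F x \<bullet> F x) \<le> (A x *v F x) \<bullet> F x" if "x \<in> space (lebesgue_on \<Omega>)" for x
      using assms(1) that by (auto simp: spd_field_def dot_square_norm inner_commute)
  qed (use assms domain_lmeasurable[OF mesh] in
      \<open>auto intro!: ess_bounded_integrable_inner ess_bounded_spd_mult integrable_mult_right\<close>)
  then show ?thesis
    by (simp add: ip_def)
qed

lemma grad_diff_AE:
  assumes "piecewise_quad Th p" "piecewise_quad Th q"
  shows "AE x in lebesgue_on \<Omega>. grad (\<lambda>y. p y - q y) x = grad p x - grad q x"
  using AE_interior[OF mesh]
proof eventually_elim
  case (elim x)
  then show ?case
    using piecewise_quad_differentiable[OF assms(1)] piecewise_quad_differentiable[OF assms(2)]
    by (auto simp: grad_def vec_eq_iff pd_diff)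
qed

lemma Vh_diff_AE:
  assumes "v \<in> Vh \<Omega> Th \<Gamma>" "w \<in> Vh \<Omega> Th \<Gamma>"
  shows "AE x in lebesgue_on \<Omega>. epsm (\<lambda>y. v y - w y) x = epsm v x - epsm w x"
    and "AE x in lebesgue_on \<Omega>. divg (\<lambda>y. v y - w y) x = divg v x - divg w x"
proof -
  have *: "AE x in lebesgue_on \<Omega>. \<forall>j. pd (\<lambda>y. v y - w y) j x = pd v j x - pd w j x"
    using AE_interior[OF mesh]
    by eventually_elim (use Vh_differentiable[OF assms(1)] Vh_differentiable[OF assms(2)] pd_diff in blast)
  show "AE x in lebesgue_on \<Omega>. epsm (\<lambda>y. v y - w y) x = epsm v x - epsm w x"
    using * by eventually_elim (simp add: vec_eq_iff epsm_component diff_divide_distrib add_divide_distrib)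
  show "AE x in lebesgue_on \<Omega>. divg (\<lambda>y. v y - w y) x = divg v x - divg w x"
    using * by eventually_elim (simp add: divg_def)
qed

text \<open>\<open>F\<close> will be a function of \<open>Qh\<close>, a gradient or a symmetric
  gradient, and the affine function one entry of it on \<open>K\<close>. Affine functions suffice
  because first derivatives of quadratics are affine.\<close>

lemma affine_piece_coeffs_tendsto_0:
  fixes F :: "nat \<Rightarrow> real^2 \<Rightarrow> 'a::euclidean_space"
  assumes "K \<in> Th" "\<And>i. ess_bounded \<Omega> (F i)" "(\<lambda>i. ip \<Omega> (F i) (F i)) \<longlonglongrightarrow> 0"
    and "\<And>i x. x \<in> interior K \<Longrightarrow> (a i + b i * x$1 + c i * x$2)\<^sup>2 \<le> F i x \<bullet> F i x"
  shows "a \<longlonglongrightarrow> 0" "b \<longlonglongrightarrow> 0" "c \<longlonglongrightarrow> 0"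
proof -
  define l where "l i x = a i + b i * x$1 + c i * x$2" for i and x :: "real^2"
  have "ip (interior K) (l i) (l i) \<le> ip \<Omega> (F i) (F i)" for i
  proof (rule ip_mono)
    show "l i \<in> borel_measurable (lebesgue_on (interior K))"
      unfolding l_def
      by (intro continuous_imp_measurable_on_sets_lebesgue continuous_intros) simp
  qed (use assms domain_lmeasurable[OF mesh] interior_subset_domain[OF mesh] in \<open>auto simp: l_def\<close>)
  then have lim: "(\<lambda>i. ip (interior K) (l i) (l i)) \<longlonglongrightarrow> 0"
    by (intro tendsto_sandwich[OF _ _ tendsto_const assms(3)] always_eventually allI ip_nonneg)
  note K = mesh_triangle[OF mesh assms(1)]
  have bd: "bounded (interior K)"
    by (meson K bounded_interior compact_imp_bounded triangle_compact)
  show "a \<longlonglongrightarrow> 0" "b \<longlonglongrightarrow> 0" "c \<longlonglongrightarrow> 0"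
    using affine_coeffs_tendsto_0[OF open_interior triangle_interior_nonempty[OF K] bd l_def lim]
    by blast+
qed

lemma bounded_mesh_triangle: "K \<in> Th \<Longrightarrow> bounded K"
  using mesh_triangle[OF mesh] triangle_compact compact_imp_bounded by blast

text \<open>The full L2 norm controls every coefficient of an affine piece, so each triangle is
  treated alone, without boundary values or passage across edges.\<close>

lemma Qh_uniform_limit:
  assumes q: "\<And>i. q i \<in> Qh \<Omega> Th" and lim: "(\<lambda>i. ip \<Omega> (q i) (q i)) \<longlonglongrightarrow> 0"
  shows "uniform_limit (closure \<Omega>) q (\<lambda>_. 0) sequentially"
proof -
  have "uniform_limit K q (\<lambda>_. 0) sequentially" if K: "K \<in> Th" for K
  proof -
    have "\<exists>c. (\<forall>x\<in>K. q i x = quad c x) \<and> c 0 2 = 0 \<and> c 1 1 = 0 \<and> c 2 0 = 0" for i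
    proof -
      obtain p where "Pk 1 p" "\<forall>x\<in>K. q i x = p x"
        using QhD[OF q K] by blast
      then show ?thesis
        using Pk1_quad[of p] by auto
    qed
    then obtain c where c: "\<And>i x. x \<in> K \<Longrightarrow> q i x = quad (c i) x"
      and z: "\<And>i. c i 0 2 = 0" "\<And>i. c i 1 1 = 0" "\<And>i. c i 2 0 = 0"
      by metis
    have "q i x = c i 0 0 + c i 1 0 * x$1 + c i 0 1 * x$2" if "x \<in> interior K" for i x
      using c[of x i] z subsetD[OF interior_subset that] by (simp add: quad_def)
    then have le: "(c i 0 0 + c i 1 0 * x$1 + c i 0 1 * x$2)\<^sup>2 \<le> q i x \<bullet> q i x" if "x \<in> interior K" for i x
      using that by (simp add: power2_eq_square)
    note t = affine_piece_coeffs_tendsto_0[OF K ess_bounded_piecewise_quad[OF Qh_piecewise_quad[OF q]] lim le]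
    show ?thesis
      by (rule uniform_limit_quad[OF bounded_mesh_triangle[OF K] c]) (use t z in auto)
  qed
  then have "uniform_limit (\<Union>Th) q (\<lambda>_. 0) sequentially"
    using mesh_finite[OF mesh] by (intro uniform_limit_on_Union)
  then show ?thesis
    using closure_domain_subset[OF mesh] by (rule uniform_limit_on_subset)
qed

text \<open>On each triangle the gradient misses only the constant coefficient, which is recovered
  by solving the polynomial identity at \<open>s\<close> for it.\<close>

lemma Wh_uniform_limit:
  assumes "connected \<Omega>" "\<exists>a b. a \<noteq> b \<and> closed_segment a b \<subseteq> frontier \<Omega>"
    and q: "\<And>i. q i \<in> Wh \<Omega> Th" and lim: "(\<lambda>i. ip \<Omega> (grad (q i)) (grad (q i))) \<longlonglongrightarrow> 0"
  shows "uniform_limit (closure \<Omega>) q (\<lambda>_. 0) sequentially"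
proof (rule uniform_limit_mesh[OF mesh assms(1,2) order_refl])
  show "q i x = 0" if "x \<in> frontier \<Omega>" for i x
    using q[of i] that by (simp add: Wh_def)
  fix K s t assume K: "K \<in> Th" and s: "s \<in> K" and ls: "(\<lambda>i. q i s) \<longlonglongrightarrow> 0"
  have pq: "piecewise_quad Th (q i)" for i
    using q by (intro Qh_piecewise_quad Wh_subset_Qh)
  then have "\<forall>i. \<exists>c. \<forall>x\<in>K. q i x = quad c x"
    using K unfolding piecewise_quad_def by blast
  then obtain c where c: "\<And>i x. x \<in> K \<Longrightarrow> q i x = quad (c i) x"
    by metis
  note t = affine_piece_coeffs_tendsto_0[OF K ess_bounded_grad[OF pq] lim]
  have g: "pd (q i) j x ^ 2 \<le> grad (q i) x \<bullet> grad (q i) x" for i j x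
    using component_square_le_inner(1)[of "grad (q i) x" j] by (simp add: grad_def)
  have 1: "(c i 1 0 + (2 * c i 2 0) * x$1 + c i 1 1 * x$2)\<^sup>2 \<le> grad (q i) x \<bullet> grad (q i) x"
    if "x \<in> interior K" for i x
    using g[of i 1 x] pd_quad_1[of K "q i" "c i" x] c that by simp
  have 2: "(c i 0 1 + c i 1 1 * x$1 + (2 * c i 0 2) * x$2)\<^sup>2 \<le> grad (q i) x \<bullet> grad (q i) x"
    if "x \<in> interior K" for i x
    using g[of i 2 x] pd_quad_2[of K "q i" "c i" x] c that by simp
  have half: "f \<longlonglongrightarrow> 0" if "(\<lambda>i. 2 * f i) \<longlonglongrightarrow> 0" for f :: "nat \<Rightarrow> real"
    using tendsto_mult_right_zero[OF that, of "1/2"] by simp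
  have l: "(\<lambda>i. c i 0 1) \<longlonglongrightarrow> 0" "(\<lambda>i. c i 0 2) \<longlonglongrightarrow> 0" "(\<lambda>i. c i 1 0) \<longlonglongrightarrow> 0"
      "(\<lambda>i. c i 1 1) \<longlonglongrightarrow> 0" "(\<lambda>i. c i 2 0) \<longlonglongrightarrow> 0"
    using t(1)[OF 2] half[OF t(3)[OF 2]] t(1)[OF 1] t(3)[OF 1] half[OF t(2)[OF 1]]
    by simp_all
  have "(\<lambda>i. q i s - (c i 0 1 * s$2 + c i 0 2 * (s$2)\<^sup>2 + c i 1 0 * s$1 + c i 1 1 * (s$1 * s$2)
      + c i 2 0 * (s$1)\<^sup>2)) \<longlonglongrightarrow> 0 - (0 * s$2 + 0 * (s$2)\<^sup>2 + 0 * s$1 + 0 * (s$1 * s$2) + 0 * (s$1)\<^sup>2)"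
    by (intro tendsto_intros l ls)
  then have "(\<lambda>i. c i 0 0) \<longlonglongrightarrow> 0"
    unfolding c[OF s] by (simp add: quad_def)
  then show "uniform_limit K q (\<lambda>_. 0) sequentially"
    by (intro uniform_limit_quad[OF bounded_mesh_triangle[OF K] c] l)
qed

text \<open>On a triangle the symmetric gradient controls all coefficients of a quadratic field except those
  of an infinitesimal rigid motion, and the values at two distinct points control the latter.\<close>
lemma Vh_uniform_limit:
  assumes "connected \<Omega>" "\<exists>a b. a \<noteq> b \<and> closed_segment a b \<subseteq> \<Gamma>" "\<Gamma> \<subseteq> frontier \<Omega>"
    and v: "\<And>i. v i \<in> Vh \<Omega> Th \<Gamma>" and lim: "(\<lambda>i. ip \<Omega> (epsm (v i)) (epsm (v i))) \<longlonglongrightarrow> 0"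
  shows "uniform_limit (closure \<Omega>) v (\<lambda>_. 0) sequentially"
proof (rule uniform_limit_mesh[OF mesh assms(1,2,3)])
  show "v i x = 0" if "x \<in> \<Gamma>" for i x
    using v[of i] that by (simp add: Vh_def)
  fix K s t assume K: "K \<in> Th" and s: "s \<in> K" and t: "t \<in> K" and st: "s \<noteq> t"
    and ls: "(\<lambda>i. v i s) \<longlonglongrightarrow> 0" and lt: "(\<lambda>i. v i t) \<longlonglongrightarrow> 0"
  have "\<exists>c. \<forall>x\<in>K. v i x $ j = quad c x" for i j
    using Vh_piecewise_quad[OF v[of i], of j] K unfolding piecewise_quad_def by blast
  then obtain C where C: "\<And>i j x. x \<in> K \<Longrightarrow> v i x $ j = quad (C i j) x"
    by metis
  define a b where "a i = C i 1" and "b i = C i 2" for i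
  have a: "v i x $ 1 = quad (a i) x" and b: "v i x $ 2 = quad (b i) x" if "x \<in> K" for i x
    using C that by (auto simp: a_def b_def)
  have pc: "pd (v i) k x $ j = pd (\<lambda>y. v i y $ j) k x" if "x \<in> interior K" for i j k x
    using Vh_differentiable[OF v K that] by (rule pd_component)
  note L = affine_piece_coeffs_tendsto_0[OF K ess_bounded_Vh(1)[OF v] lim]
  have g': "(pd (v i) j x $ j)\<^sup>2 \<le> epsm (v i) x \<bullet> epsm (v i) x" for i j x
    using component_square_le_inner(2)[of "epsm (v i) x" j j] by (simp add: epsm_component)
  have g: "((pd (v i) j x $ k + pd (v i) k x $ j) / 2) ^ 2 \<le> epsm (v i) x \<bullet> epsm (v i) x" for i j k x
    using component_square_le_inner(2)[of "epsm (v i) x" k j] by (simp add: epsm_component)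
  have 11: "(a i 1 0 + (2 * a i 2 0) * x$1 + a i 1 1 * x$2)\<^sup>2 \<le> epsm (v i) x \<bullet> epsm (v i) x"
    if "x \<in> interior K" for i x
    using g'[of i 1 x] pd_quad_1[of K "\<lambda>y. v i y $ 1" "a i" x, OF a that]
    unfolding pc[OF that] by simp
  have 22: "(b i 0 1 + b i 1 1 * x$1 + (2 * b i 0 2) * x$2)\<^sup>2 \<le> epsm (v i) x \<bullet> epsm (v i) x"
    if "x \<in> interior K" for i x
    using g'[of i 2 x] pd_quad_2[of K "\<lambda>y. v i y $ 2" "b i" x, OF b that]
    unfolding pc[OF that] by simp
  \<comment> \<open>The off-diagonal entry mixes the two components. Each of its first-order
    coefficients pairs a coefficient already controlled by a diagonal entry with a new one, which is
    thereby isolated.\<close>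
  have 12: "((a i 0 1 + b i 1 0) / 2 + (a i 1 1 / 2 + b i 2 0) * x$1 + (a i 0 2 + b i 1 1 / 2) * x$2)\<^sup>2
      \<le> epsm (v i) x \<bullet> epsm (v i) x"
    if "x \<in> interior K" for i x
  proof -
    have "(pd (v i) 2 x $ 1 + pd (v i) 1 x $ 2) / 2
        = (a i 0 1 + b i 1 0) / 2 + (a i 1 1 / 2 + b i 2 0) * x$1 + (a i 0 2 + b i 1 1 / 2) * x$2"
      using pd_quad_2[of K "\<lambda>y. v i y $ 1" "a i" x] a that pc[OF that, of i]
        pd_quad_1[of K "\<lambda>y. v i y $ 2" "b i" x] b by (simp add: field_simps)
    then show ?thesis
      using g[of i 2 x 1] by (simp only:)
  qed
  have half: "f \<longlonglongrightarrow> 0" if "(\<lambda>i. 2 * f i) \<longlonglongrightarrow> 0" for f :: "nat \<Rightarrow> real"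
    using tendsto_mult_right_zero[OF that, of "1/2"] by simp
  have la: "(\<lambda>i. a i 1 0) \<longlonglongrightarrow> 0" "(\<lambda>i. a i 1 1) \<longlonglongrightarrow> 0" "(\<lambda>i. a i 2 0) \<longlonglongrightarrow> 0"
    using L(1)[OF 11] L(3)[OF 11] half[OF L(2)[OF 11]]
    by simp_all
  have lb: "(\<lambda>i. b i 0 1) \<longlonglongrightarrow> 0" "(\<lambda>i. b i 1 1) \<longlonglongrightarrow> 0" "(\<lambda>i. b i 0 2) \<longlonglongrightarrow> 0"
    using L(1)[OF 22] L(2)[OF 22] half[OF L(3)[OF 22]]
    by simp_all
  have lb2: "(\<lambda>i. b i 2 0) \<longlonglongrightarrow> 0"
    using tendsto_diff[OF L(2)[OF 12] tendsto_divide_zero[OF la(2), of 2]] by simp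
  have la2: "(\<lambda>i. a i 0 2) \<longlonglongrightarrow> 0"
    using tendsto_diff[OF L(3)[OF 12] tendsto_divide_zero[OF lb(2), of 2]] by simp
  \<comment> \<open>Only the sum is controlled: the difference of these two coefficients is the
    infinitesimal rotation, which \<open>epsm\<close> does not see.\<close>
  have skew: "(\<lambda>i. a i 0 1 + b i 1 0) \<longlonglongrightarrow> 0"
  proof -
    have "(\<lambda>i. 2 * ((a i 0 1 + b i 1 0) / 2)) \<longlonglongrightarrow> 0"
      using L(1)[OF 12] by (intro tendsto_mult_right_zero) simp
    then show ?thesis
      by (simp only: times_divide_eq_right nonzero_mult_div_cancel_left)
  qed
  \<comment> \<open>Once the vanishing terms are removed, a translation and a rotation term are all
    that remains of the first component; \<open>rb\<close> is the analogue for the second.\<close>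
  have ra: "(\<lambda>i. a i 0 0 + a i 0 1 * x$2) \<longlonglongrightarrow> 0" if "x \<in> K" "(\<lambda>i. v i x) \<longlonglongrightarrow> 0" for x
  proof -
    have "(\<lambda>i. v i x $ 1 - (a i 0 2 * (x$2)\<^sup>2 + a i 1 0 * x$1 + a i 1 1 * (x$1 * x$2)
        + a i 2 0 * (x$1)\<^sup>2)) \<longlonglongrightarrow> (0::real^2) $ 1 - (0 * (x$2)\<^sup>2 + 0 * x$1 + 0 * (x$1 * x$2) + 0 * (x$1)\<^sup>2)"
      by (intro tendsto_intros tendsto_vec_nth la la2 that)
    then show ?thesis
      unfolding a[OF that(1)] by (simp add: quad_def)
  qed
  have rb: "(\<lambda>i. b i 0 0 + b i 1 0 * x$1) \<longlonglongrightarrow> 0" if "x \<in> K" "(\<lambda>i. v i x) \<longlonglongrightarrow> 0" for x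
  proof -
    have "(\<lambda>i. v i x $ 2 - (b i 0 1 * x$2 + b i 0 2 * (x$2)\<^sup>2 + b i 1 1 * (x$1 * x$2)
        + b i 2 0 * (x$1)\<^sup>2)) \<longlonglongrightarrow> (0::real^2) $ 2 - (0 * x$2 + 0 * (x$2)\<^sup>2 + 0 * (x$1 * x$2) + 0 * (x$1)\<^sup>2)"
      by (intro tendsto_intros tendsto_vec_nth lb lb2 that)
    then show ?thesis
      unfolding b[OF that(1)] by (simp add: quad_def algebra_simps)
  qed
  have "(\<lambda>i. a i 0 1) \<longlonglongrightarrow> 0 \<and> (\<lambda>i. b i 1 0) \<longlonglongrightarrow> 0"
  \<comment> \<open>Distinct points differ in some coordinate. Subtracting the values at
    \<open>s\<close> and \<open>t\<close> cancels the translation and isolates the rotation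
    coefficient of one component; \<open>skew\<close> then yields that of the other.\<close>
  proof (cases "s$2 = t$2")
    case False
    have "(\<lambda>i. a i 0 1 * (s$2 - t$2)) \<longlonglongrightarrow> 0"
      using tendsto_diff[OF ra[OF s ls] ra[OF t lt]] by (simp add: algebra_simps)
    from tendsto_divide_zero[OF this, of "s$2 - t$2"] False
    have "(\<lambda>i. a i 0 1) \<longlonglongrightarrow> 0" by simp
    with tendsto_diff[OF skew this] show ?thesis by simp
  next
    case True
    then have ne: "s$1 \<noteq> t$1"
      using st by (auto simp: vec_eq_iff forall_2)
    have "(\<lambda>i. b i 1 0 * (s$1 - t$1)) \<longlonglongrightarrow> 0"
      using tendsto_diff[OF rb[OF s ls] rb[OF t lt]] by (simp add: algebra_simps)
    from tendsto_divide_zero[OF this, of "s$1 - t$1"] ne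
    have "(\<lambda>i. b i 1 0) \<longlonglongrightarrow> 0" by simp
    with tendsto_diff[OF skew this] show ?thesis by simp
  qed
  then have la3: "(\<lambda>i. a i 0 1) \<longlonglongrightarrow> 0" and lb3: "(\<lambda>i. b i 1 0) \<longlonglongrightarrow> 0" by auto
  have la4: "(\<lambda>i. a i 0 0) \<longlonglongrightarrow> 0"
    using tendsto_diff[OF ra[OF s ls] tendsto_mult_left_zero[OF la3, of "s$2"]] by simp
  have lb4: "(\<lambda>i. b i 0 0) \<longlonglongrightarrow> 0"
    using tendsto_diff[OF rb[OF s ls] tendsto_mult_left_zero[OF lb3, of "s$1"]] by simp
  have "uniform_limit K (\<lambda>i x. v i x $ 1) (\<lambda>_. 0) sequentially"
    by (intro uniform_limit_quad[OF bounded_mesh_triangle[OF K] a] la la2 la3 la4)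
  moreover have "uniform_limit K (\<lambda>i x. v i x $ 2) (\<lambda>_. 0) sequentially"
    by (intro uniform_limit_quad[OF bounded_mesh_triangle[OF K] b] lb lb2 lb3 lb4)
  ultimately have "uniform_limit K (\<lambda>i x. v i x $ j) (\<lambda>_. 0) sequentially" for j
    using exhaust_2[of j] by auto
  then show "uniform_limit K v (\<lambda>_. 0) sequentially"
    by (rule uniform_limit_vec_0)
qed

lemma ip_uniform_limit_0:
  assumes "\<And>i. ess_bounded \<Omega> (z i)" "uniform_limit \<Omega> z (\<lambda>_. 0) sequentially"
  shows "(\<lambda>i. ip \<Omega> (z i) (z i)) \<longlonglongrightarrow> 0"
proof (rule LIMSEQ_I)
  let ?m = "measure lebesgue \<Omega>"
  note \<Omega> = domain_lmeasurable[OF mesh]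
  fix \<epsilon> :: real assume \<epsilon>: "0 < \<epsilon>"
  \<comment> \<open>Chosen so that measure times \<open>\<delta>\<close> squared stays below
    \<open>\<epsilon>\<close>; the added 1 makes this strict and avoids division by zero.\<close>
  define \<delta> where "\<delta> = sqrt (\<epsilon> / (?m + 1))"
  have m: "?m + 1 > 0" by (simp add: add_nonneg_pos)
  have \<delta>: "\<delta> > 0" "\<delta>\<^sup>2 = \<epsilon> / (?m + 1)"
    using \<epsilon> m by (auto simp: \<delta>_def)
  have "ip \<Omega> (z i) (z i) < \<epsilon>" if i: "\<forall>x\<in>\<Omega>. dist (z i x) 0 < \<delta>" for i
  proof -
    have "ip \<Omega> (z i) (z i) \<le> (\<integral>x. \<delta>\<^sup>2 \<partial>lebesgue_on \<Omega>)"
      unfolding ip_def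
    proof (rule integral_mono)
      show "integrable (lebesgue_on \<Omega>) (\<lambda>x. z i x \<bullet> z i x)"
        by (intro ess_bounded_integrable_inner assms \<Omega>)
      show "integrable (lebesgue_on \<Omega>) (\<lambda>x. \<delta>\<^sup>2)"
        using finite_measure.integrable_const[OF finite_measure_lebesgue_on[OF \<Omega>]] .
      show "z i x \<bullet> z i x \<le> \<delta>\<^sup>2" if "x \<in> space (lebesgue_on \<Omega>)" for x
        using i that power_mono[of "norm (z i x)" \<delta> 2] by (simp add: dot_square_norm less_imp_le)
    qed
    also have "\<dots> = ?m * \<delta>\<^sup>2"
      using \<Omega> by (simp add: measure_restrict_space fmeasurableD)
    also have "\<dots> < \<epsilon>"
      unfolding \<delta>(2) using \<epsilon> m by (simp add: field_simps)
    finally show ?thesis .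
  qed
  note small = this
  obtain N where N: "\<forall>i\<ge>N. \<forall>x\<in>\<Omega>. dist (z i x) 0 < \<delta>"
    using uniform_limitD[OF assms(2) \<delta>(1)] by (auto simp: eventually_sequentially)
  show "\<exists>N. \<forall>i\<ge>N. norm (ip \<Omega> (z i) (z i) - 0) < \<epsilon>"
  proof (intro exI allI impI)
    fix i assume "N \<le> i"
    then show "norm (ip \<Omega> (z i) (z i) - 0) < \<epsilon>"
      using small[of i] N ip_nonneg[of \<Omega> "z i"] by simp
  qed
qed

end

section \<open>Energy estimates and convergence\<close>

text \<open>The errors are indexed from the first computed iterate, since \<open>uI 0\<close> is
  unconstrained; a shift of the index does not change the limit.\<close>

lemma uniform_limit_Suc_diff:
  fixes l :: "'a \<Rightarrow> 'b::real_normed_vector"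
  assumes "uniform_limit S (\<lambda>i x. f (Suc i) x - l x) (\<lambda>_. 0) sequentially"
  shows "uniform_limit S f l sequentially"
proof (rule uniform_limitI)
  fix \<epsilon> :: real assume "0 < \<epsilon>"
  then have "\<forall>\<^sub>F i in sequentially. \<forall>x\<in>S. dist (f (Suc i) x) (l x) < \<epsilon>"
    using uniform_limitD[OF assms] by (simp add: dist_norm)
  then show "\<forall>\<^sub>F i in sequentially. \<forall>x\<in>S. dist (f i x) (l x) < \<epsilon>"
    by (rule eventually_sequentially_Suc[THEN iffD1])
qed

text \<open>Consecutive differences of a convergent sequence vanish whatever its limit, so the limit
  of \<open>B\<close> need not be identified here.\<close>

lemma decrement_tendsto_0:
  fixes B d :: "nat \<Rightarrow> real"
  assumes "\<And>i. B (Suc i) + d i \<le> B i" "\<And>i. 0 \<le> B i" "\<And>i. 0 \<le> d i"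
  shows "d \<longlonglongrightarrow> 0"
proof -
  have "decseq B"
    using assms(1,3) by (intro decseq_SucI) (metis add_increasing2 dual_order.refl order_trans)
  then obtain L where L: "B \<longlonglongrightarrow> L"
    using decseq_convergent[of B 0] assms(2) by blast
  have "(\<lambda>i. B i - B (Suc i)) \<longlonglongrightarrow> L - L"
    by (intro tendsto_diff L LIMSEQ_Suc)
  then have lim: "(\<lambda>i. B i - B (Suc i)) \<longlonglongrightarrow> 0"
    by simp
  have le: "d i \<le> B i - B (Suc i)" for i
    using assms(1)[of i] by linarith
  show ?thesis
    by (rule tendsto_sandwich[OF _ _ tendsto_const lim]) (use assms(3) le in auto)
qed

text \<open>\<open>P\<close>, \<open>R\<close>, \<open>X\<close> stand for the products of e_p and
  e_T with themselves and with each other, \<open>XP\<close> and \<open>XT\<close> for their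
  products with the preceding error in xi, \<open>GP\<close> and \<open>GT\<close> for the diffusion
  terms. The sum of both equations times \<open>lam\<close> contains the complete square
  \<open>Z\<close>; the right-hand side is estimated by \<open>Y\<close>, which costs half of
  \<open>Z\<close>.\<close>

lemma flow_energy:
  fixes P R X XP XT GP GT Z B :: real
  assumes "c0 \<ge> b0" "a0 \<ge> b0" "b0 \<ge> 0" "lam > 0"
    and 1: "(c0 + alpha^2 / lam) * P + (alpha * beta / lam - b0) * X + dt * GP = alpha / lam * XP"
    and 2: "(a0 + beta^2 / lam) * R + (alpha * beta / lam - b0) * X + dt * GT = beta / lam * XT"
    and Z: "Z = alpha^2 * P + 2 * alpha * beta * X + beta^2 * R"
    and Y: "2 * (alpha * XP + beta * XT) \<le> Z + B" and "2 * X \<le> P + R" "0 \<le> P" "0 \<le> R"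
  shows "Z + 2 * lam * (dt * GP + dt * GT) \<le> B"
proof -
  \<comment> \<open>\<open>X\<close> may have either sign; the storage coefficients dominate
    \<open>b0\<close> and absorb the coupling term \<open>2 * b0 * X\<close>.\<close>
  have "b0 * (2 * X) \<le> b0 * (P + R)"
    using assms by (intro mult_left_mono) auto
  also have "\<dots> \<le> c0 * P + a0 * R"
    unfolding distrib_left using assms by (intro add_mono mult_right_mono) auto
  finally have 3: "0 \<le> lam * (c0 * P + a0 * R - 2 * b0 * X)"
    using assms by simp
  have "lam * (c0 * P + a0 * R - 2 * b0 * X) + Z + lam * (dt * GP + dt * GT)
      = lam * ((c0 + alpha^2 / lam) * P + (alpha * beta / lam - b0) * X + dt * GP
          + ((a0 + beta^2 / lam) * R + (alpha * beta / lam - b0) * X + dt * GT))"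
    unfolding Z using assms(4) by (simp add: field_simps power2_eq_square)
  also have "\<dots> = alpha * XP + beta * XT"
    unfolding 1 2 using assms(4) by (simp add: field_simps)
  finally have 4: "lam * (c0 * P + a0 * R - 2 * b0 * X) + Z + lam * (dt * GP + dt * GT)
      = alpha * XP + beta * XT" .
  have "Z + 2 * V \<le> B" if "0 \<le> U" "U + Z + V = W" "2 * W \<le> Z + B" for U V W
    using that by linarith
  from this[OF 3 4 Y] show ?thesis
    by (simp only: mult.assoc)
qed

text \<open>\<open>D\<close> is the divergence coupling, which occurs in both tested equations and
  is eliminated. After scaling by \<open>lam\<close>, Young's inequality costs half of
  \<open>B\<close>; doubling the rest turns \<open>2 * mu\<close> into
  \<open>4 * mu\<close>.\<close>

lemma elasticity_energy:
  fixes E D B Z ZX :: real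
  assumes "lam > 0" "2 * mu * E = D" "D + 1 / lam * B = 1 / lam * ZX" "2 * ZX \<le> Z + B"
  shows "B + 4 * mu * lam * E \<le> Z"
proof -
  have "lam * (D + 1 / lam * B) = ZX"
    unfolding assms(3) using assms(1) by simp
  moreover have "lam * (D + 1 / lam * B) = lam * D + B"
    using assms(1) by (simp add: distrib_left)
  ultimately have "2 * (lam * (2 * mu * E)) + 2 * B \<le> Z + B"
    using assms(2,4) by simp
  then show ?thesis
    by (simp add: mult_ac)
qed

theorem theorem4p2:
  fixes \<Omega> \<Gamma>d :: "(real^2) set" and Th :: "(real^2) set set"
    and K \<Theta> :: "real^2 \<Rightarrow> real^2^2"
    and km kM \<theta>m \<theta>M lam mu alpha beta a0 b0 c0 dt \<gamma> :: real
    and f :: "real^2 \<Rightarrow> real^2" and g Hs :: "real^2 \<Rightarrow> real"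
    and xi0 p0 T0 :: "real^2 \<Rightarrow> real"
    and u :: "real^2 \<Rightarrow> real^2" and xi p T :: "real^2 \<Rightarrow> real"
    and uI :: "nat \<Rightarrow> real^2 \<Rightarrow> real^2" and xiI pI TI :: "nat \<Rightarrow> real^2 \<Rightarrow> real"
  assumes mesh: "triangulation \<Omega> Th" and dom: "connected \<Omega>"
    and GD: "\<Gamma>d \<subseteq> frontier \<Omega>" "\<Gamma>d \<noteq> frontier \<Omega>"
      "\<exists>a b. a \<noteq> b \<and> closed_segment a b \<subseteq> \<Gamma>d"
    and infsup: "\<gamma> > 0" "inf_sup \<Omega> Th \<Gamma>d \<gamma>"
    and A1: "km > 0" "kM > 0" "\<theta>m > 0" "\<theta>M > 0"
      "spd_field \<Omega> K km kM" "spd_field \<Omega> \<Theta> \<theta>m \<theta>M"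
    and A2: "lam > 0" "mu > 0" "alpha > 0" "beta > 0"
    and A3: "a0 \<ge> b0" "c0 \<ge> b0" "b0 \<ge> 0"
    and data: "L2fun \<Omega> f" "L2fun \<Omega> g" "L2fun \<Omega> Hs"
    and dt: "dt > 0"
    and prev: "xi0 \<in> Qh \<Omega> Th" "p0 \<in> Wh \<Omega> Th" "T0 \<in> Wh \<Omega> Th"
    and sol_sp: "u \<in> Vh \<Omega> Th \<Gamma>d" "xi \<in> Qh \<Omega> Th" "p \<in> Wh \<Omega> Th" "T \<in> Wh \<Omega> Th"
    and sol1: "\<forall>v\<in>Vh \<Omega> Th \<Gamma>d.
        2 * mu * ip \<Omega> (epsm u) (epsm v) - ip \<Omega> (divg v) xi = ip \<Omega> f v"
    and sol2: "\<forall>\<phi>\<in>Qh \<Omega> Th.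
        - ip \<Omega> (divg u) \<phi> - 1 / lam * ip \<Omega> xi \<phi> + alpha / lam * ip \<Omega> p \<phi>
          + beta / lam * ip \<Omega> T \<phi> = 0"
    and sol3: "\<forall>q\<in>Wh \<Omega> Th.
        - (alpha / lam) * ip \<Omega> xi q + (c0 + alpha^2 / lam) * ip \<Omega> p q
          + (alpha * beta / lam - b0) * ip \<Omega> T q
          + dt * ip \<Omega> (\<lambda>x. K x *v grad p x) (grad q)
        = (c0 + alpha^2 / lam) * ip \<Omega> p0 q + (alpha * beta / lam - b0) * ip \<Omega> T0 q
          - alpha / lam * ip \<Omega> xi0 q + dt * ip \<Omega> g q"
    and sol4: "\<forall>S\<in>Wh \<Omega> Th.
        - (beta / lam) * ip \<Omega> xi S + (a0 + beta^2 / lam) * ip \<Omega> T S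
          + (alpha * beta / lam - b0) * ip \<Omega> p S
          + dt * ip \<Omega> (\<lambda>x. \<Theta> x *v grad T x) (grad S)
        = (a0 + beta^2 / lam) * ip \<Omega> T0 S + (alpha * beta / lam - b0) * ip \<Omega> p0 S
          - beta / lam * ip \<Omega> xi0 S + dt * ip \<Omega> Hs S"
    and init: "xiI 0 = xi0" "pI 0 = p0" "TI 0 = T0"
    and step1: "\<forall>i\<ge>1. pI i \<in> Wh \<Omega> Th \<and> TI i \<in> Wh \<Omega> Th
      \<and> (\<forall>q\<in>Wh \<Omega> Th.
          (c0 + alpha^2 / lam) * ip \<Omega> (pI i) q + (alpha * beta / lam - b0) * ip \<Omega> (TI i) q
            + dt * ip \<Omega> (\<lambda>x. K x *v grad (pI i) x) (grad q)
          = dt * ip \<Omega> g q + (c0 + alpha^2 / lam) * ip \<Omega> p0 q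
            + (alpha * beta / lam - b0) * ip \<Omega> T0 q
            + alpha / lam * ip \<Omega> (xiI (i - 1)) q - alpha / lam * ip \<Omega> xi0 q)
      \<and> (\<forall>S\<in>Wh \<Omega> Th.
          (a0 + beta^2 / lam) * ip \<Omega> (TI i) S + (alpha * beta / lam - b0) * ip \<Omega> (pI i) S
            + dt * ip \<Omega> (\<lambda>x. \<Theta> x *v grad (TI i) x) (grad S)
          = dt * ip \<Omega> Hs S + (a0 + beta^2 / lam) * ip \<Omega> T0 S
            + (alpha * beta / lam - b0) * ip \<Omega> p0 S
            + beta / lam * ip \<Omega> (xiI (i - 1)) S - beta / lam * ip \<Omega> xi0 S)"
    and step2: "\<forall>i\<ge>1. uI i \<in> Vh \<Omega> Th \<Gamma>d \<and> xiI i \<in> Qh \<Omega> Th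
      \<and> (\<forall>v\<in>Vh \<Omega> Th \<Gamma>d.
          2 * mu * ip \<Omega> (epsm (uI i)) (epsm v) - ip \<Omega> (divg v) (xiI i) = ip \<Omega> f v)
      \<and> (\<forall>\<phi>\<in>Qh \<Omega> Th.
          ip \<Omega> (divg (uI i)) \<phi> + 1 / lam * ip \<Omega> (xiI i) \<phi>
          = alpha / lam * ip \<Omega> (pI i) \<phi> + beta / lam * ip \<Omega> (TI i) \<phi>)"
  shows "uniform_limit (closure \<Omega>) uI u sequentially
       \<and> uniform_limit (closure \<Omega>) xiI xi sequentially
       \<and> uniform_limit (closure \<Omega>) pI p sequentially
       \<and> uniform_limit (closure \<Omega>) TI T sequentially"
proof -
  note \<Omega> = domain_lmeasurable[OF mesh]
  \<comment> \<open>\<open>ex\<close> alone is not shifted: the flow step computing iterate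
    \<open>Suc i\<close> reads \<open>xiI i\<close>, starting with the initial guess
    \<open>xiI 0\<close>, and the mechanics step then produces \<open>ex (Suc i)\<close>.\<close>
  define eu where "eu i x = uI (Suc i) x - u x" for i x
  define ex where "ex i x = xiI i x - xi x" for i x
  define ep where "ep i x = pI (Suc i) x - p x" for i x
  define eT where "eT i x = TI (Suc i) x - T x" for i x
  define z where "z i x = alpha *\<^sub>R ep i x + beta *\<^sub>R eT i x" for i x

  have uI: "uI (Suc i) \<in> Vh \<Omega> Th \<Gamma>d" and pI: "pI (Suc i) \<in> Wh \<Omega> Th" and TI: "TI (Suc i) \<in> Wh \<Omega> Th" for i
    using step1[rule_format, of "Suc i"] step2[rule_format, of "Suc i"] by auto
  have xiI: "xiI i \<in> Qh \<Omega> Th" for i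
    using step2[rule_format, of i] init(1) prev(1) by (cases i) auto
  have eu: "eu i \<in> Vh \<Omega> Th \<Gamma>d" for i
    unfolding eu_def by (intro Vh_diff uI sol_sp)
  have ex: "ex i \<in> Qh \<Omega> Th" for i
    unfolding ex_def by (intro Qh_diff xiI sol_sp)
  have ep: "ep i \<in> Wh \<Omega> Th" and eT: "eT i \<in> Wh \<Omega> Th" for i
    unfolding ep_def eT_def by (intro Wh_diff pI TI sol_sp)+
  note WQ = Wh_subset_Qh
  have pq: "piecewise_quad Th q" if "q \<in> Qh \<Omega> Th" for q
    using that by (rule Qh_piecewise_quad)
  have bQ: "ess_bounded \<Omega> q" if "q \<in> Qh \<Omega> Th" for q
    using ess_bounded_piecewise_quad[OF mesh pq[OF that]] .
  have bG: "ess_bounded \<Omega> (grad q)" if "q \<in> Wh \<Omega> Th" for q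
    using ess_bounded_grad[OF mesh pq[OF WQ[OF that]]] .
  note bV = ess_bounded_Vh[OF mesh]

  \<comment> \<open>Linearity of the bilinear forms on differences of discrete functions\<close>
  have dQ: "ip \<Omega> (\<lambda>x. a x - b x) q = ip \<Omega> a q - ip \<Omega> b q"
    if "a \<in> Qh \<Omega> Th" "b \<in> Qh \<Omega> Th" "q \<in> Qh \<Omega> Th" for a b q
    by (rule ip_diff_AE[OF \<Omega> bQ[OF that(1)] bQ[OF that(2)] bQ[OF that(3)]
          _ bQ[OF Qh_diff[OF that(1,2)]]]) simp
  have dG: "ip \<Omega> (\<lambda>x. A x *v grad (\<lambda>y. a y - b y) x) (grad q)
      = ip \<Omega> (\<lambda>x. A x *v grad a x) (grad q) - ip \<Omega> (\<lambda>x. A x *v grad b x) (grad q)"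
    if "spd_field \<Omega> A m M" "0 < M" "a \<in> Wh \<Omega> Th" "b \<in> Wh \<Omega> Th" "q \<in> Wh \<Omega> Th" for A m M a b q
  proof (rule ip_diff_AE[OF \<Omega>])
    show "AE x in lebesgue_on \<Omega>. A x *v grad (\<lambda>y. a y - b y) x = A x *v grad a x - A x *v grad b x"
      using grad_diff_AE[OF mesh pq[OF WQ[OF that(3)]] pq[OF WQ[OF that(4)]]]
      by eventually_elim (simp add: matrix_vector_mult_diff_distrib)
  qed (use that in \<open>auto intro!: ess_bounded_spd_mult[OF mesh that(1,2)] bG Wh_diff\<close>)
  have dE: "ip \<Omega> (epsm (\<lambda>y. a y - b y)) (epsm v) = ip \<Omega> (epsm a) (epsm v) - ip \<Omega> (epsm b) (epsm v)"
    if "a \<in> Vh \<Omega> Th \<Gamma>d" "b \<in> Vh \<Omega> Th \<Gamma>d" "v \<in> Vh \<Omega> Th \<Gamma>d" for a b v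
    by (rule ip_diff_AE[OF \<Omega> bV(1)[OF that(1)] bV(1)[OF that(2)] bV(1)[OF that(3)]
          Vh_diff_AE(1)[OF mesh that(1,2)] bV(1)[OF Vh_diff[OF that(1,2)]]])
  have dD: "ip \<Omega> (divg (\<lambda>y. a y - b y)) q = ip \<Omega> (divg a) q - ip \<Omega> (divg b) q"
    if "a \<in> Vh \<Omega> Th \<Gamma>d" "b \<in> Vh \<Omega> Th \<Gamma>d" "q \<in> Qh \<Omega> Th" for a b q
    by (rule ip_diff_AE[OF \<Omega> bV(2)[OF that(1)] bV(2)[OF that(2)] bQ[OF that(3)]
          Vh_diff_AE(2)[OF mesh that(1,2)] bV(2)[OF Vh_diff[OF that(1,2)]]])
  have dX: "ip \<Omega> (divg v) (\<lambda>x. a x - b x) = ip \<Omega> (divg v) a - ip \<Omega> (divg v) b"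
    if "v \<in> Vh \<Omega> Th \<Gamma>d" "a \<in> Qh \<Omega> Th" "b \<in> Qh \<Omega> Th" for v a b
    unfolding ip_commute[of \<Omega> "divg v"]
    by (rule ip_diff_AE[OF \<Omega> bQ[OF that(2)] bQ[OF that(3)] bV(2)[OF that(1)]
          _ bQ[OF Qh_diff[OF that(2,3)]]]) simp

  \<comment> \<open>Error equations, in which loads and previous time level cancel\<close>
  have err1: "2 * mu * ip \<Omega> (epsm (eu i)) (epsm v) = ip \<Omega> (divg v) (ex (Suc i))"
    if v: "v \<in> Vh \<Omega> Th \<Gamma>d" for i v
  proof -
    have "2 * mu * ip \<Omega> (epsm (uI (Suc i))) (epsm v) - ip \<Omega> (divg v) (xiI (Suc i)) = ip \<Omega> f v"
      using step2 v by simp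
    with sol1 v show ?thesis
      unfolding eu_def ex_def dE[OF uI sol_sp(1) v] dX[OF v xiI sol_sp(2)]
      by (simp add: algebra_simps)
  qed
  have err2: "ip \<Omega> (divg (eu i)) q + 1 / lam * ip \<Omega> (ex (Suc i)) q
      = alpha / lam * ip \<Omega> (ep i) q + beta / lam * ip \<Omega> (eT i) q"
    if q: "q \<in> Qh \<Omega> Th" for i q
  proof -
    have "ip \<Omega> (divg (uI (Suc i))) q + 1 / lam * ip \<Omega> (xiI (Suc i)) q
        = alpha / lam * ip \<Omega> (pI (Suc i)) q + beta / lam * ip \<Omega> (TI (Suc i)) q"
      using step2 q by simp
    \<comment> \<open>The two equations are added rather than subtracted, since the coupled problem
      states this one with the opposite sign.\<close>
    with sol2[rule_format, OF q] show ?thesis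
      unfolding eu_def ex_def ep_def eT_def dD[OF uI sol_sp(1) q] dQ[OF xiI sol_sp(2) q]
        dQ[OF WQ[OF pI] WQ[OF sol_sp(3)] q] dQ[OF WQ[OF TI] WQ[OF sol_sp(4)] q] right_diff_distrib
      by linarith
  qed
  have err3: "(c0 + alpha^2 / lam) * ip \<Omega> (ep i) q + (alpha * beta / lam - b0) * ip \<Omega> (eT i) q
      + dt * ip \<Omega> (\<lambda>x. K x *v grad (ep i) x) (grad q) = alpha / lam * ip \<Omega> (ex i) q"
    if q: "q \<in> Wh \<Omega> Th" for i q
  proof -
    have "(c0 + alpha^2 / lam) * ip \<Omega> (pI (Suc i)) q + (alpha * beta / lam - b0) * ip \<Omega> (TI (Suc i)) q
            + dt * ip \<Omega> (\<lambda>x. K x *v grad (pI (Suc i)) x) (grad q)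
          = dt * ip \<Omega> g q + (c0 + alpha^2 / lam) * ip \<Omega> p0 q
            + (alpha * beta / lam - b0) * ip \<Omega> T0 q
            + alpha / lam * ip \<Omega> (xiI i) q - alpha / lam * ip \<Omega> xi0 q"
      using step1[rule_format, of "Suc i"] q by simp
    with sol3[rule_format, OF q] show ?thesis
      unfolding ex_def ep_def eT_def dQ[OF xiI sol_sp(2) WQ[OF q]]
        dQ[OF WQ[OF pI] WQ[OF sol_sp(3)] WQ[OF q]] dQ[OF WQ[OF TI] WQ[OF sol_sp(4)] WQ[OF q]]
        dG[OF A1(5,2) pI sol_sp(3) q] right_diff_distrib
      by linarith
  qed
  have err4: "(a0 + beta^2 / lam) * ip \<Omega> (eT i) S + (alpha * beta / lam - b0) * ip \<Omega> (ep i) S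
      + dt * ip \<Omega> (\<lambda>x. \<Theta> x *v grad (eT i) x) (grad S) = beta / lam * ip \<Omega> (ex i) S"
    if S: "S \<in> Wh \<Omega> Th" for i S
  proof -
    have "(a0 + beta^2 / lam) * ip \<Omega> (TI (Suc i)) S + (alpha * beta / lam - b0) * ip \<Omega> (pI (Suc i)) S
            + dt * ip \<Omega> (\<lambda>x. \<Theta> x *v grad (TI (Suc i)) x) (grad S)
          = dt * ip \<Omega> Hs S + (a0 + beta^2 / lam) * ip \<Omega> T0 S
            + (alpha * beta / lam - b0) * ip \<Omega> p0 S
            + beta / lam * ip \<Omega> (xiI i) S - beta / lam * ip \<Omega> xi0 S"
      using step1[rule_format, of "Suc i"] S by simp
    with sol4[rule_format, OF S] show ?thesis
      unfolding ex_def ep_def eT_def dQ[OF xiI sol_sp(2) WQ[OF S]]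
        dQ[OF WQ[OF pI] WQ[OF sol_sp(3)] WQ[OF S]] dQ[OF WQ[OF TI] WQ[OF sol_sp(4)] WQ[OF S]]
        dG[OF A1(6,4) TI sol_sp(4) S] right_diff_distrib
      by linarith
  qed

  \<comment> \<open>Energy quantities and their estimates over one iteration\<close>
  define B where "B i = ip \<Omega> (ex i) (ex i)" for i
  define Z where "Z i = ip \<Omega> (z i) (z i)" for i
  define GP where "GP i = ip \<Omega> (grad (ep i)) (grad (ep i))" for i
  define GT where "GT i = ip \<Omega> (grad (eT i)) (grad (eT i))" for i
  define EU where "EU i = ip \<Omega> (epsm (eu i)) (epsm (eu i))" for i
  have nonneg: "0 \<le> B i" "0 \<le> Z i" "0 \<le> GP i" "0 \<le> GT i" "0 \<le> EU i" for i
    unfolding B_def Z_def GP_def GT_def EU_def by (rule ip_nonneg)+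
  note bp = bQ[OF WQ[OF ep]] and bT = bQ[OF WQ[OF eT]]
  have bz: "ess_bounded \<Omega> (z i)" for i
    unfolding z_def by (intro ess_bounded_add ess_bounded_scaleR bp bT)
  have zq: "ip \<Omega> (z i) q = alpha * ip \<Omega> (ep i) q + beta * ip \<Omega> (eT i) q" if "ess_bounded \<Omega> q" for i q
    unfolding z_def by (simp only: ip_add_left[OF \<Omega> ess_bounded_scaleR[OF bp] ess_bounded_scaleR[OF bT] that]
        ip_scaleR_left)

  \<comment> \<open>\<open>err3\<close> is tested with \<open>ep i\<close> and \<open>err4\<close>
    with \<open>eT i\<close>; the lower ellipticity bounds then replace the diffusion terms by the
    plain gradient norms.\<close>
  have flow: "Z i + 2 * lam * (dt * (km * GP i) + dt * (\<theta>m * GT i)) \<le> B i" for i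
  proof -
    have "Z i = alpha * ip \<Omega> (z i) (ep i) + beta * ip \<Omega> (z i) (eT i)"
      unfolding Z_def zq[OF bz] by (simp only: ip_commute[of \<Omega> "z i"])
    then have Z: "Z i = alpha^2 * ip \<Omega> (ep i) (ep i) + 2 * alpha * beta * ip \<Omega> (eT i) (ep i)
        + beta^2 * ip \<Omega> (eT i) (eT i)"
      unfolding zq[OF bp] zq[OF bT] ip_commute[of \<Omega> "ep i" "eT i"]
      by (simp add: algebra_simps power2_eq_square)
    have "2 * ip \<Omega> (z i) (ex i) \<le> Z i + B i"
      unfolding Z_def B_def by (rule ip_Young[OF \<Omega> bz bQ[OF ex]])
    then have Y: "2 * (alpha * ip \<Omega> (ex i) (ep i) + beta * ip \<Omega> (ex i) (eT i)) \<le> Z i + B i"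
      unfolding zq[OF bQ[OF ex]] by (simp only: ip_commute[of \<Omega> "ex i"])
    have "Z i + 2 * lam * (dt * ip \<Omega> (\<lambda>x. K x *v grad (ep i) x) (grad (ep i))
        + dt * ip \<Omega> (\<lambda>x. \<Theta> x *v grad (eT i) x) (grad (eT i))) \<le> B i"
    proof (rule flow_energy[OF A3(2,1,3) A2(1) err3[OF ep] _ Z Y])
      show "(a0 + beta^2 / lam) * ip \<Omega> (eT i) (eT i) + (alpha * beta / lam - b0) * ip \<Omega> (eT i) (ep i)
        + dt * ip \<Omega> (\<lambda>x. \<Theta> x *v grad (eT i) x) (grad (eT i)) = beta / lam * ip \<Omega> (ex i) (eT i)"
        using err4[OF eT, of i i] by (simp only: ip_commute[of \<Omega> "ep i"])
      show "2 * ip \<Omega> (eT i) (ep i) \<le> ip \<Omega> (ep i) (ep i) + ip \<Omega> (eT i) (eT i)"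
        using ip_Young[OF \<Omega> bT bp] by (simp add: add.commute)
    qed (rule ip_nonneg)+
    moreover have "dt * (km * GP i) + dt * (\<theta>m * GT i) \<le> dt * ip \<Omega> (\<lambda>x. K x *v grad (ep i) x) (grad (ep i))
        + dt * ip \<Omega> (\<lambda>x. \<Theta> x *v grad (eT i) x) (grad (eT i))"
      unfolding GP_def GT_def using dt ip_spd_ge[OF mesh A1(5,2) bG[OF ep]] ip_spd_ge[OF mesh A1(6,4) bG[OF eT]]
      by (intro add_mono mult_left_mono) auto
    then have "2 * lam * (dt * (km * GP i) + dt * (\<theta>m * GT i))
      \<le> 2 * lam * (dt * ip \<Omega> (\<lambda>x. K x *v grad (ep i) x) (grad (ep i))
        + dt * ip \<Omega> (\<lambda>x. \<Theta> x *v grad (eT i) x) (grad (eT i)))"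
      using A2(1) by (intro mult_left_mono) auto
    ultimately show ?thesis by linarith
  qed
  have elast: "B (Suc i) + 4 * mu * lam * EU i \<le> Z i" for i
  proof (rule elasticity_energy[OF A2(1)])
    show "2 * mu * EU i = ip \<Omega> (divg (eu i)) (ex (Suc i))"
      unfolding EU_def by (rule err1[OF eu])
    show "ip \<Omega> (divg (eu i)) (ex (Suc i)) + 1 / lam * B (Suc i) = 1 / lam * ip \<Omega> (z i) (ex (Suc i))"
      unfolding B_def err2[OF ex] zq[OF bQ[OF ex]] by (simp add: algebra_simps)
    show "2 * ip \<Omega> (z i) (ex (Suc i)) \<le> Z i + B (Suc i)"
      unfolding Z_def B_def by (rule ip_Young[OF \<Omega> bz bQ[OF ex]])
  qed

  \<comment> \<open>Vanishing of the dissipation\<close>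
  have lim0: "G \<longlonglongrightarrow> 0" if "k > 0" "\<And>i. 0 \<le> G i" "\<And>i. B (Suc i) + k * G i \<le> B i" for k and G :: "nat \<Rightarrow> real"
    using tendsto_divide_zero[OF decrement_tendsto_0[of B "\<lambda>i. k * G i"], of k] that nonneg by simp
  have "GP \<longlonglongrightarrow> 0"
  proof (rule lim0)
    \<comment> \<open>\<open>elast\<close> and \<open>flow\<close> are chained through
      \<open>Z i\<close>, and the nonnegative dissipation terms other than the one at hand are
      dropped; the next two limits arise in the same way.\<close>
    show "B (Suc i) + (2 * lam * dt * km) * GP i \<le> B i" for i
    proof -
      have "0 \<le> 2 * lam * (dt * (\<theta>m * GT i))" "0 \<le> 4 * mu * lam * EU i"
        using nonneg A1 A2 dt by simp_all
      then show ?thesis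
        using flow[of i] elast[of i] by (simp add: algebra_simps)
    qed
  qed (use A1 A2 dt nonneg in auto)
  moreover have "GT \<longlonglongrightarrow> 0"
  proof (rule lim0)
    show "B (Suc i) + (2 * lam * dt * \<theta>m) * GT i \<le> B i" for i
    proof -
      have "0 \<le> 2 * lam * (dt * (km * GP i))" "0 \<le> 4 * mu * lam * EU i"
        using nonneg A1 A2 dt by simp_all
      then show ?thesis
        using flow[of i] elast[of i] by (simp add: algebra_simps)
    qed
  qed (use A1 A2 dt nonneg in auto)
  moreover have "EU \<longlonglongrightarrow> 0"
  proof (rule lim0)
    show "B (Suc i) + (4 * mu * lam) * EU i \<le> B i" for i
    proof -
      have "0 \<le> 2 * lam * (dt * (km * GP i) + dt * (\<theta>m * GT i))"
        using nonneg A1 A2 dt by simp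
      then show ?thesis
        using flow[of i] elast[of i] by linarith
    qed
  qed (use A2 nonneg in auto)
  moreover have seg: "\<exists>a b. a \<noteq> b \<and> closed_segment a b \<subseteq> frontier \<Omega>"
    using GD by blast
  ultimately have up: "uniform_limit (closure \<Omega>) ep (\<lambda>_. 0) sequentially"
    and uT: "uniform_limit (closure \<Omega>) eT (\<lambda>_. 0) sequentially"
    and uu: "uniform_limit (closure \<Omega>) eu (\<lambda>_. 0) sequentially"
    unfolding GP_def GT_def EU_def
    by (auto intro!: Wh_uniform_limit[OF mesh dom seg] Vh_uniform_limit[OF mesh dom GD(3,1)] ep eT eu)

  \<comment> \<open>Convergence of the error in xi\<close>
  have "uniform_limit (closure \<Omega>) z (\<lambda>_. alpha *\<^sub>R 0 + beta *\<^sub>R 0) sequentially"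
    unfolding z_def
    by (intro uniform_limit_add bounded_linear.uniform_limit[OF bounded_linear_scaleR_right] up uT)
  then have "uniform_limit \<Omega> z (\<lambda>_. 0) sequentially"
    by (simp add: uniform_limit_on_subset[OF _ closure_subset])
  then have Z0: "Z \<longlonglongrightarrow> 0"
    unfolding Z_def by (rule ip_uniform_limit_0[OF mesh bz])
  \<comment> \<open>Monotonicity left the limit of \<open>B\<close> open; \<open>elast\<close>
    without its elastic energy pins it down, as \<open>Z\<close> is now known to vanish.\<close>
  have BZ: "B (Suc i) \<le> Z i" for i
  proof -
    have "0 \<le> 4 * mu * lam * EU i"
      using nonneg A2 by simp
    then show ?thesis
      using elast[of i] by linarith
  qed
  have "(\<lambda>i. B (Suc i)) \<longlonglongrightarrow> 0"
    by (rule tendsto_sandwich[OF _ _ tendsto_const Z0]) (use nonneg(1) BZ in auto)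
  then have ux: "uniform_limit (closure \<Omega>) (\<lambda>i. ex (Suc i)) (\<lambda>_. 0) sequentially"
    unfolding B_def by (rule Qh_uniform_limit[OF mesh, of "\<lambda>i. ex (Suc i)", OF ex])
  have "uniform_limit (closure \<Omega>) uI u sequentially"
    by (rule uniform_limit_Suc_diff) (rule uu[unfolded eu_def])
  moreover have "uniform_limit (closure \<Omega>) xiI xi sequentially"
    by (rule uniform_limit_Suc_diff) (rule ux[unfolded ex_def])
  moreover have "uniform_limit (closure \<Omega>) pI p sequentially"
    by (rule uniform_limit_Suc_diff) (rule up[unfolded ep_def])
  moreover have "uniform_limit (closure \<Omega>) TI T sequentially"
    by (rule uniform_limit_Suc_diff) (rule uT[unfolded eT_def])
  ultimately show ?thesis
    by blast
qed

end
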